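(* Let $\mathbf{k}$ be a field and let $(H,m_H,\Delta_H,\alpha_H,\psi_H,R)$ be a quasitriangular hom-bialgebra over $\mathbf{k}$, with notation $R=\sum_i s_i\otimes t_i$, such that $(\alpha_H\otimes\alpha_H)(R)=R=(\psi_H\otimes\psi_H)(R)$. If $(M,\alpha_M)$ is a left $H$-module, then the linear map $B:M\otimes M\to M\otimes M$, $B(m\otimes m')=\sum_i t_i\cdot m'\otimes s_i\cdot m$ for all $m,m'\in M$, is a solution of the hom-Yang-Baxter equation with respect to $\alpha_M$.
   Context: All vector spaces, tensor products and linear maps are over $\mathbf{k}$; algebras and coalgebras are not assumed (co)unital. A hom-associative $\mathbf{k}$-algebra is a triple $(A,m_A,\alpha_A)$ with $m_A:A\otimes A\to A$ linear (written $ab$) and $\alpha_A:A\to A$ linear such that $\alpha_A(ab)=\alpha_A(a)\alpha_A(b)$ and $\alpha_A(a)(bc)=(ab)\alpha_A(c)$. A morphism is a linear map commuting with multiplications and structure maps; $A\otimes A$ is hom-associative with componentwise multiplication and structure map $\alpha_A\otimes\alpha_A$. A hom-coassociative coalgebra is $(C,\Delta_C,\psi_C)$ with $\Delta_C:C\to C\otimes C$, $\psi_C:C\to C$ linear, $(\psi_C\otimes\psi_C)\circ\Delta_C=\Delta_C\circ\psi_C$ and $(\Delta_C\otimes\psi_C)\circ\Delta_C=(\psi_C\otimes\Delta_C)\circ\Delta_C$; morphisms are linear maps commuting with comultiplications and structure maps. A hom-bialgebra $(B,m_B,\Delta_B,\alpha_B,\psi_B)$ consists of a hom-associative algebra $(B,m_B,\alpha_B)$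 and a hom-coassociative coalgebra $(B,\Delta_B,\psi_B)$ such that $\Delta_B$ and $\psi_B$ are morphisms of hom-associative algebras and $\alpha_B$ is a morphism of hom-coassociative coalgebras. A quasitriangular hom-bialgebra is a hom-bialgebra $(H,m,\Delta,\alpha,\psi)$ with an element $R=\sum_i s_i\otimes t_i\in H\otimes H$ such that $R\Delta(h)=\Delta^{\mathrm{cop}}(h)R$ for all $h\in H$ (where $\Delta(h)=\sum h_{(1)}\otimes h_{(2)}$, $\Delta^{\mathrm{cop}}(h)=\sum h_{(2)}\otimes h_{(1)}$), $(\Delta\otimes\alpha)(R)=\sum_{i,j}\psi(s_i)\otimes\psi(s_j)\otimes t_it_j$, and $(\alpha\otimes\Delta)(R)=\sum_{i,j}s_is_j\otimes\psi(t_j)\otimes\psi(t_i)$. A left $H$-module is a pair $(M,\alpha_M)$, $\alpha_M:M\to M$ linear, with a linear action $H\otimes M\to M$, $h\otimes m\mapsto h\cdot m$, such that $\alpha_M(h\cdot m)=\alpha_H(h)\cdot\alpha_M(m)$ and $\alpha_H(h)\cdot(h'\cdot m)=(hh')\cdot\alpha_M(m)$. Hom-Yang-Baxter equation: for a vector space $V$ and a linear map $\alpha_V:V\to V$, a linear map $d_V:V\otimes V\to V\otimes V$ with $(\alpha_V\otimes\alpha_V)\circ d_V=d_V\circ(\alpha_V\otimes\alpha_V)$ is a solution of the hom-Yang-Baxter equation with respect to $\alpha_V$ if $(d_V\otimes\alpha_V)\circ(\alpha_V\otimes d_V)\circ(d_V\otimes\alpha_V)=(\alpha_V\otimes d_V)\circ(d_V\otimes\alpha_V)\circ(\alpha_V\otimes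 d_V)$. *)

theory Defs
  imports "Jordan_Normal_Form.Missing_VectorSpace" "HOL-Algebra.AbelCoset"
begin

section \<open>Tensor products of vector spaces\<close>

text \<open>The free vector space on \<open>X\<close>: finitely supported functions on \<open>X\<close>.\<close>

definition free_space :: "('k, 'r) ring_scheme \<Rightarrow> 'x set \<Rightarrow> ('k, 'x \<Rightarrow> 'k) module" where
  "free_space K X = (ring.func_space K X)
     \<lparr>carrier := {f \<in> X \<rightarrow>\<^sub>E carrier K. finite {x \<in> X. f x \<noteq> \<zero>\<^bsub>K\<^esub>}}\<rparr>"

definition free_gen :: "('k, 'r) ring_scheme \<Rightarrow> 'x set \<Rightarrow> 'x \<Rightarrow> ('x \<Rightarrow> 'k)" where
  "free_gen K X x = (\<lambda>y\<in>X. if y = x then \<one>\<^bsub>K\<^esub> else \<zero>\<^bsub>K\<^esub>)"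

text \<open>The \<open>mult\<close> and \<open>one\<close> fields are irrelevant for modules and set to dummy values.\<close>

definition quotient_space :: "('k, 'v, 'z) module_scheme \<Rightarrow> 'v set \<Rightarrow> ('k, 'v set) module" where
  "quotient_space V U =
     \<lparr>carrier = a_rcosets\<^bsub>V\<^esub> U, mult = (\<lambda>X Y. U), one = U, zero = U,
      add = (\<lambda>X Y. X <+>\<^bsub>V\<^esub> Y), smult = (\<lambda>c X. \<Union>x\<in>X. U +>\<^bsub>V\<^esub> (c \<odot>\<^bsub>V\<^esub> x))\<rparr>"

definition tensor_free ::
    "('k, 'r) ring_scheme \<Rightarrow> ('k, 'v, 'y) module_scheme \<Rightarrow> ('k, 'w, 'z) module_scheme
      \<Rightarrow> ('k, 'v \<times> 'w \<Rightarrow> 'k) module" where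
  "tensor_free K V W = free_space K (carrier V \<times> carrier W)"

definition tensor_relators ::
    "('k, 'r) ring_scheme \<Rightarrow> ('k, 'v, 'y) module_scheme \<Rightarrow> ('k, 'w, 'z) module_scheme
      \<Rightarrow> ('v \<times> 'w \<Rightarrow> 'k) set" where
  "tensor_relators K V W =
    (let F = tensor_free K V W; g = free_gen K (carrier V \<times> carrier W) in
       {g (v \<oplus>\<^bsub>V\<^esub> v', w) \<ominus>\<^bsub>F\<^esub> (g (v, w) \<oplus>\<^bsub>F\<^esub> g (v', w)) | v v' w.
          v \<in> carrier V \<and> v' \<in> carrier V \<and> w \<in> carrier W}
     \<union> {g (v, w \<oplus>\<^bsub>W\<^esub> w') \<ominus>\<^bsub>F\<^esub> (g (v, w) \<oplus>\<^bsub>F\<^esub> g (v, w')) | v w w'.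
          v \<in> carrier V \<and> w \<in> carrier W \<and> w' \<in> carrier W}
     \<union> {g (c \<odot>\<^bsub>V\<^esub> v, w) \<ominus>\<^bsub>F\<^esub> (c \<odot>\<^bsub>F\<^esub> g (v, w)) | c v w.
          c \<in> carrier K \<and> v \<in> carrier V \<and> w \<in> carrier W}
     \<union> {g (v, c \<odot>\<^bsub>W\<^esub> w) \<ominus>\<^bsub>F\<^esub> (c \<odot>\<^bsub>F\<^esub> g (v, w)) | c v w.
          c \<in> carrier K \<and> v \<in> carrier V \<and> w \<in> carrier W})"

definition tensor_null ::
    "('k, 'r) ring_scheme \<Rightarrow> ('k, 'v, 'y) module_scheme \<Rightarrow> ('k, 'w, 'z) module_scheme
      \<Rightarrow> ('v \<times> 'w \<Rightarrow> 'k) set" where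
  "tensor_null K V W = module.span K (tensor_free K V W) (tensor_relators K V W)"

definition tensor ::
    "('k, 'r) ring_scheme \<Rightarrow> ('k, 'v, 'y) module_scheme \<Rightarrow> ('k, 'w, 'z) module_scheme
      \<Rightarrow> ('k, ('v \<times> 'w \<Rightarrow> 'k) set) module" where
  "tensor K V W = quotient_space (tensor_free K V W) (tensor_null K V W)"

text \<open>\<open>tens K V W v w\<close> is the pure tensor \<open>v \<otimes> w\<close> in \<open>tensor K V W\<close>.\<close>

definition tens ::
    "('k, 'r) ring_scheme \<Rightarrow> ('k, 'v, 'y) module_scheme \<Rightarrow> ('k, 'w, 'z) module_scheme
      \<Rightarrow> 'v \<Rightarrow> 'w \<Rightarrow> ('v \<times> 'w \<Rightarrow> 'k) set" where
  "tens K V W v w = tensor_null K V W +>\<^bsub>tensor_free K V W\<^esub> free_gen K (carrier V \<times> carrier W) (v, w)"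

text \<open>
  \<open>tensor_lift K V W P f\<close> is the linear map on \<open>tensor K V W\<close> induced by a bilinear map
  \<open>f : V \<times> W \<rightarrow> P\<close>; that it exists and is unique is the lemma \<open>tensor_universal\<close> below.
\<close>

definition bilinear_map ::
    "('k, 'r) ring_scheme \<Rightarrow> ('k, 'v, 'x) module_scheme \<Rightarrow> ('k, 'w, 'y) module_scheme
      \<Rightarrow> ('k, 'p, 'z) module_scheme \<Rightarrow> ('v \<Rightarrow> 'w \<Rightarrow> 'p) \<Rightarrow> bool" where
  "bilinear_map K V W P f \<longleftrightarrow>
     (\<forall>w\<in>carrier W. (\<lambda>v. f v w) \<in> module_hom K V P) \<and>
     (\<forall>v\<in>carrier V. f v \<in> module_hom K W P)"

definition tensor_lift ::
    "('k, 'r) ring_scheme \<Rightarrow> ('k, 'v, 'x) module_scheme \<Rightarrow> ('k, 'w, 'y) module_scheme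
      \<Rightarrow> ('k, 'p, 'z) module_scheme \<Rightarrow> ('v \<Rightarrow> 'w \<Rightarrow> 'p) \<Rightarrow> ('v \<times> 'w \<Rightarrow> 'k) set \<Rightarrow> 'p" where
  "tensor_lift K V W P f =
     (THE L. L \<in> extensional (carrier (tensor K V W)) \<and> linear_map K (tensor K V W) P L \<and>
             (\<forall>v\<in>carrier V. \<forall>w\<in>carrier W. L (tens K V W v w) = f v w))"

subsection \<open>The free vector space\<close>

lemma free_space_carrier:
  "carrier (free_space K X) = {f \<in> X \<rightarrow>\<^sub>E carrier K. finite {x \<in> X. f x \<noteq> \<zero>\<^bsub>K\<^esub>}}"
  by (simp add: free_space_def)

lemma (in cring) free_space_simps:
  "\<zero>\<^bsub>free_space R X\<^esub> = (\<lambda>x\<in>X. \<zero>)"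
  "f \<oplus>\<^bsub>free_space R X\<^esub> g = (\<lambda>x\<in>X. f x \<oplus> g x)"
  "c \<odot>\<^bsub>free_space R X\<^esub> f = (\<lambda>x\<in>X. c \<otimes> f x)"
  by (simp_all add: free_space_def func_space_def)

lemma (in cring) free_space_module: "module R (free_space R X)"
proof -
  interpret F: module R "func_space X" by (rule func_space_is_module)
  have "LinearCombinations.submodule R {f \<in> X \<rightarrow>\<^sub>E carrier R. finite {x \<in> X. f x \<noteq> \<zero>}} (func_space X)"
  proof (rule LinearCombinations.submodule.intro)
    show "module R (func_space X)" by (rule func_space_is_module)
  next
    fix f g assume f: "f \<in> {f \<in> X \<rightarrow>\<^sub>E carrier R. finite {x \<in> X. f x \<noteq> \<zero>}}"
      and g: "g \<in> {f \<in> X \<rightarrow>\<^sub>E carrier R. finite {x \<in> X. f x \<noteq> \<zero>}}"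
    have "{x \<in> X. f x \<oplus> g x \<noteq> \<zero>} \<subseteq> {x \<in> X. f x \<noteq> \<zero>} \<union> {x \<in> X. g x \<noteq> \<zero>}"
      by auto
    then have "finite {x \<in> X. f x \<oplus> g x \<noteq> \<zero>}"
      by (rule finite_subset) (use f g in auto)
    then show "f \<oplus>\<^bsub>func_space X\<^esub> g \<in> {f \<in> X \<rightarrow>\<^sub>E carrier R. finite {x \<in> X. f x \<noteq> \<zero>}}"
      using f g by (auto simp: func_space_def PiE_mem2 cong: conj_cong)
  next
    fix c f assume c: "c \<in> carrier R" and f: "f \<in> {f \<in> X \<rightarrow>\<^sub>E carrier R. finite {x \<in> X. f x \<noteq> \<zero>}}"
    have "{x \<in> X. c \<otimes> f x \<noteq> \<zero>} \<subseteq> {x \<in> X. f x \<noteq> \<zero>}"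
      using c by auto
    then have "finite {x \<in> X. c \<otimes> f x \<noteq> \<zero>}"
      by (rule finite_subset) (use f in auto)
    then show "c \<odot>\<^bsub>func_space X\<^esub> f \<in> {f \<in> X \<rightarrow>\<^sub>E carrier R. finite {x \<in> X. f x \<noteq> \<zero>}}"
      using f c by (auto simp: func_space_def PiE_mem2 cong: conj_cong)
  qed (auto simp: func_space_def)
  from F.submodule_is_module[OF this] show ?thesis
    by (simp add: free_space_def)
qed

lemma (in cring) free_gen_closed: "free_gen R X x \<in> carrier (free_space R X)"
proof -
  have "finite {y \<in> X. free_gen R X x y \<noteq> \<zero>}"
    by (rule finite_subset[of _ "{x}"]) (auto simp: free_gen_def)
  then show ?thesis by (auto simp: free_space_carrier free_gen_def)
qed

text \<open>The linear extension of a family of vectors to the free vector space.\<close>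

definition free_ext :: "('k, 'r) ring_scheme \<Rightarrow> 'x set \<Rightarrow> ('k, 'p, 'z) module_scheme \<Rightarrow> ('x \<Rightarrow> 'p) \<Rightarrow> ('x \<Rightarrow> 'k) \<Rightarrow> 'p"
  where "free_ext K X P e f = (\<Oplus>\<^bsub>P\<^esub>x\<in>{x \<in> X. f x \<noteq> \<zero>\<^bsub>K\<^esub>}. f x \<odot>\<^bsub>P\<^esub> e x)"

lemma (in module) free_ext_superset:
  assumes "finite A" "A \<subseteq> X" "{x \<in> X. f x \<noteq> \<zero>} \<subseteq> A" "f \<in> X \<rightarrow> carrier R" "e \<in> X \<rightarrow> carrier M"
  shows "free_ext R X M e f = (\<Oplus>\<^bsub>M\<^esub>x\<in>A. f x \<odot>\<^bsub>M\<^esub> e x)"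
proof -
  have "f x \<odot>\<^bsub>M\<^esub> e x = \<zero>\<^bsub>M\<^esub>" if "x \<in> A - {x \<in> X. f x \<noteq> \<zero>}" for x
  proof -
    have "x \<in> X" "f x = \<zero>" using that assms(2) by auto
    then show ?thesis using assms(5) by (auto simp: Pi_iff)
  qed
  moreover have "f x \<odot>\<^bsub>M\<^esub> e x \<in> carrier M" if "x \<in> A" for x
    using that assms(2,4,5) by (auto simp: Pi_iff)
  ultimately show ?thesis
    unfolding free_ext_def using assms(1,3)
    by (intro M.add.finprod_mono_neutral_cong_left) auto
qed

lemma (in module) free_ext_hom:
  assumes e: "e \<in> X \<rightarrow> carrier M"
  shows "free_ext R X M e \<in> module_hom R (free_space R X) M"
proof -
  let ?F = "free_space R X"
  interpret F: module R ?F by (rule free_space_module)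
  have cl: "free_ext R X M e f \<in> carrier M" if "f \<in> carrier ?F" for f
    unfolding free_ext_def
    by (rule M.finsum_closed) (use that e in \<open>auto simp: free_space_carrier\<close>)
  have add: "free_ext R X M e (f \<oplus>\<^bsub>?F\<^esub> g) = free_ext R X M e f \<oplus>\<^bsub>M\<^esub> free_ext R X M e g"
    if f: "f \<in> carrier ?F" and g: "g \<in> carrier ?F" for f g
  proof -
    let ?A = "{x \<in> X. f x \<noteq> \<zero>} \<union> {x \<in> X. g x \<noteq> \<zero>}"
    have fin: "finite ?A" using f g by (auto simp: free_space_carrier)
    have fc: "f \<in> X \<rightarrow> carrier R" and gc: "g \<in> X \<rightarrow> carrier R" using f g by (auto simp: free_space_carrier)
    have fgc: "f \<oplus>\<^bsub>?F\<^esub> g \<in> X \<rightarrow> carrier R" using fc gc by (auto simp: free_space_simps)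
    have 1: "free_ext R X M e (f \<oplus>\<^bsub>?F\<^esub> g) = (\<Oplus>\<^bsub>M\<^esub>x\<in>?A. (f \<oplus>\<^bsub>?F\<^esub> g) x \<odot>\<^bsub>M\<^esub> e x)"
      by (rule free_ext_superset[OF fin _ _ fgc e]) (auto simp: free_space_simps)
    have 2: "free_ext R X M e f = (\<Oplus>\<^bsub>M\<^esub>x\<in>?A. f x \<odot>\<^bsub>M\<^esub> e x)"
      by (rule free_ext_superset[OF fin _ _ fc e]) auto
    have 3: "free_ext R X M e g = (\<Oplus>\<^bsub>M\<^esub>x\<in>?A. g x \<odot>\<^bsub>M\<^esub> e x)"
      by (rule free_ext_superset[OF fin _ _ gc e]) auto
    have "(\<Oplus>\<^bsub>M\<^esub>x\<in>?A. (f \<oplus>\<^bsub>?F\<^esub> g) x \<odot>\<^bsub>M\<^esub> e x)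
        = (\<Oplus>\<^bsub>M\<^esub>x\<in>?A. f x \<odot>\<^bsub>M\<^esub> e x \<oplus>\<^bsub>M\<^esub> g x \<odot>\<^bsub>M\<^esub> e x)"
      by (rule M.finsum_cong') (use fc gc e in \<open>auto simp: free_space_simps Pi_iff smult_l_distr\<close>)
    also have "\<dots> = (\<Oplus>\<^bsub>M\<^esub>x\<in>?A. f x \<odot>\<^bsub>M\<^esub> e x) \<oplus>\<^bsub>M\<^esub> (\<Oplus>\<^bsub>M\<^esub>x\<in>?A. g x \<odot>\<^bsub>M\<^esub> e x)"
      by (rule M.finsum_addf) (use fc gc e in \<open>auto simp: Pi_iff\<close>)
    finally show ?thesis by (simp only: 1 2 3)
  qed
  have sm: "free_ext R X M e (c \<odot>\<^bsub>?F\<^esub> f) = c \<odot>\<^bsub>M\<^esub> free_ext R X M e f"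
    if c: "c \<in> carrier R" and f: "f \<in> carrier ?F" for c f
  proof -
    let ?A = "{x \<in> X. f x \<noteq> \<zero>}"
    have fin: "finite ?A" using f by (auto simp: free_space_carrier)
    have fc: "f \<in> X \<rightarrow> carrier R" using f by (auto simp: free_space_carrier)
    have cfc: "c \<odot>\<^bsub>?F\<^esub> f \<in> X \<rightarrow> carrier R" using c fc by (auto simp: free_space_simps)
    have "free_ext R X M e (c \<odot>\<^bsub>?F\<^esub> f) = (\<Oplus>\<^bsub>M\<^esub>x\<in>?A. (c \<odot>\<^bsub>?F\<^esub> f) x \<odot>\<^bsub>M\<^esub> e x)"
      by (rule free_ext_superset[OF fin _ _ cfc e]) (use c in \<open>auto simp: free_space_simps\<close>)
    also have "\<dots> = (\<Oplus>\<^bsub>M\<^esub>x\<in>?A. c \<odot>\<^bsub>M\<^esub> (f x \<odot>\<^bsub>M\<^esub> e x))"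
      by (rule M.finsum_cong') (use c fc e in \<open>auto simp: free_space_simps Pi_iff smult_assoc1\<close>)
    also have "\<dots> = c \<odot>\<^bsub>M\<^esub> free_ext R X M e f"
      unfolding free_ext_def
      by (rule finsum_smult_ldistr[symmetric]) (use fin c fc e in \<open>auto simp: Pi_iff\<close>)
    finally show ?thesis .
  qed
  show ?thesis unfolding module_hom_def using cl add sm by auto
qed

lemma (in module) free_ext_gen:
  assumes e: "e \<in> X \<rightarrow> carrier M" and x: "x \<in> X"
  shows "free_ext R X M e (free_gen R X x) = e x"
proof -
  have "free_ext R X M e (free_gen R X x) = (\<Oplus>\<^bsub>M\<^esub>y\<in>{x}. free_gen R X x y \<odot>\<^bsub>M\<^esub> e y)"
    by (rule free_ext_superset) (use e x in \<open>auto simp: free_gen_def\<close>)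
  then show ?thesis using e x by (auto simp: free_gen_def Pi_iff)
qed

lemma (in cring) free_space_expand:
  assumes f: "f \<in> carrier (free_space R X)"
  shows "f = free_ext R X (free_space R X) (free_gen R X) f"
proof -
  let ?F = "free_space R X"
  interpret F: module R ?F by (rule free_space_module)
  have gc: "free_gen R X \<in> X \<rightarrow> carrier ?F" using free_gen_closed by auto
  have val: "(\<Oplus>\<^bsub>?F\<^esub>x\<in>A. f x \<odot>\<^bsub>?F\<^esub> free_gen R X x) = (\<lambda>y\<in>X. if y \<in> A then f y else \<zero>)"
    if "finite A" "A \<subseteq> X" for A
    using that
  proof (induction A)
    case empty then show ?case by (simp add: free_space_simps)
  next
    case (insert a A)
    have fX: "f x \<in> carrier R" if "x \<in> X" for x using f that by (auto simp: free_space_carrier)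
    have "(\<Oplus>\<^bsub>?F\<^esub>x\<in>insert a A. f x \<odot>\<^bsub>?F\<^esub> free_gen R X x)
        = f a \<odot>\<^bsub>?F\<^esub> free_gen R X a \<oplus>\<^bsub>?F\<^esub> (\<Oplus>\<^bsub>?F\<^esub>x\<in>A. f x \<odot>\<^bsub>?F\<^esub> free_gen R X x)"
      by (rule F.finsum_insert) (use insert fX free_gen_closed in \<open>auto intro!: F.smult_closed\<close>)
    also have "\<dots> = f a \<odot>\<^bsub>?F\<^esub> free_gen R X a \<oplus>\<^bsub>?F\<^esub> (\<lambda>y\<in>X. if y \<in> A then f y else \<zero>)"
      using insert.IH insert.prems by (simp only: insert_subset)
    also have "\<dots> = (\<lambda>y\<in>X. if y \<in> insert a A then f y else \<zero>)"
    proof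
      fix y
      show "(f a \<odot>\<^bsub>?F\<^esub> free_gen R X a \<oplus>\<^bsub>?F\<^esub> (\<lambda>y\<in>X. if y \<in> A then f y else \<zero>)) y
          = (\<lambda>y\<in>X. if y \<in> insert a A then f y else \<zero>) y"
        using insert.hyps insert.prems fX[of a] fX[of y]
        by (cases "y \<in> X"; cases "y = a"; cases "y \<in> A") (simp_all add: free_space_simps free_gen_def)
    qed
    finally show ?case .
  qed
  have "free_ext R X ?F (free_gen R X) f = (\<lambda>y\<in>X. if y \<in> {x \<in> X. f x \<noteq> \<zero>} then f y else \<zero>)"
    unfolding free_ext_def by (rule val) (use f in \<open>auto simp: free_space_carrier\<close>)
  also have "\<dots> = f"
  proof
    fix y
    show "(\<lambda>y\<in>X. if y \<in> {x \<in> X. f x \<noteq> \<zero>} then f y else \<zero>) y = f y"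
      using f by (cases "y \<in> X") (auto simp: free_space_carrier PiE_def extensional_def)
  qed
  finally show ?thesis by simp
qed


subsection \<open>Quotients\<close>

lemma (in module) submodule_abelian_subgroup:
  assumes U: "LinearCombinations.submodule R U M"
  shows "abelian_subgroup U M"
proof -
  interpret U: LinearCombinations.submodule R U M by (rule U)
  have "subgroup U (add_monoid M)"
  proof (rule M.add.subgroupI)
    show "\<ominus>\<^bsub>M\<^esub> a \<in> U" if "a \<in> U" for a
      using that U.subset by (metis R.add.inv_closed R.one_closed U.smult_closed smult_minus_1 subsetD)
  qed (use U.subset in auto, use U.zero_closed in blast)
  then show ?thesis
    by (intro abelian_subgroupI3 additive_subgroupI) (auto intro: M.abelian_group_axioms)
qed

context module begin

lemma quotient_simps:
  assumes U: "LinearCombinations.submodule R U M"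
  shows "carrier (quotient_space M U) = (\<lambda>x. U +>\<^bsub>M\<^esub> x) ` carrier M"
    and "\<zero>\<^bsub>quotient_space M U\<^esub> = U"
    and "\<lbrakk>x \<in> carrier M; y \<in> carrier M\<rbrakk> \<Longrightarrow>
      (U +>\<^bsub>M\<^esub> x) \<oplus>\<^bsub>quotient_space M U\<^esub> (U +>\<^bsub>M\<^esub> y) = U +>\<^bsub>M\<^esub> (x \<oplus>\<^bsub>M\<^esub> y)"
    and "\<lbrakk>c \<in> carrier R; x \<in> carrier M\<rbrakk> \<Longrightarrow>
      c \<odot>\<^bsub>quotient_space M U\<^esub> (U +>\<^bsub>M\<^esub> x) = U +>\<^bsub>M\<^esub> (c \<odot>\<^bsub>M\<^esub> x)"
proof -
  interpret U: LinearCombinations.submodule R U M by (rule U)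
  interpret S: abelian_subgroup U M by (rule submodule_abelian_subgroup[OF U])
  show "carrier (quotient_space M U) = (\<lambda>x. U +>\<^bsub>M\<^esub> x) ` carrier M"
    by (auto simp: quotient_space_def A_RCOSETS_def RCOSETS_def a_r_coset_def)
  show "\<zero>\<^bsub>quotient_space M U\<^esub> = U" by (simp add: quotient_space_def)
  show "(U +>\<^bsub>M\<^esub> x) \<oplus>\<^bsub>quotient_space M U\<^esub> (U +>\<^bsub>M\<^esub> y) = U +>\<^bsub>M\<^esub> (x \<oplus>\<^bsub>M\<^esub> y)"
    if "x \<in> carrier M" "y \<in> carrier M"
    using that by (simp add: quotient_space_def S.a_rcos_sum)
  show "c \<odot>\<^bsub>quotient_space M U\<^esub> (U +>\<^bsub>M\<^esub> x) = U +>\<^bsub>M\<^esub> (c \<odot>\<^bsub>M\<^esub> x)"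
    if c: "c \<in> carrier R" and x: "x \<in> carrier M"
  proof -
    have "U +>\<^bsub>M\<^esub> (c \<odot>\<^bsub>M\<^esub> y) = U +>\<^bsub>M\<^esub> (c \<odot>\<^bsub>M\<^esub> x)" if y: "y \<in> U +>\<^bsub>M\<^esub> x" for y
    proof -
      obtain u where u: "u \<in> U" "y = u \<oplus>\<^bsub>M\<^esub> x" using y by (auto simp: a_r_coset_def')
      then have uM: "u \<in> carrier M" using U.subset by auto
      have "c \<odot>\<^bsub>M\<^esub> y = c \<odot>\<^bsub>M\<^esub> u \<oplus>\<^bsub>M\<^esub> c \<odot>\<^bsub>M\<^esub> x" using u uM c x by (simp add: smult_r_distr)
      moreover have "c \<odot>\<^bsub>M\<^esub> u \<in> U" using u c by simp
      ultimately have "c \<odot>\<^bsub>M\<^esub> y \<in> U +>\<^bsub>M\<^esub> (c \<odot>\<^bsub>M\<^esub> x)" by (auto simp: a_r_coset_def')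
      then show ?thesis using c x M.a_repr_independence[OF _ _ S.a_subgroup] by simp
    qed
    then have "(\<Union>y\<in>U +>\<^bsub>M\<^esub> x. U +>\<^bsub>M\<^esub> (c \<odot>\<^bsub>M\<^esub> y)) = (\<Union>y\<in>U +>\<^bsub>M\<^esub> x. U +>\<^bsub>M\<^esub> (c \<odot>\<^bsub>M\<^esub> x))"
      by (intro SUP_cong refl)
    also have "\<dots> = U +>\<^bsub>M\<^esub> (c \<odot>\<^bsub>M\<^esub> x)" using S.a_rcos_self[OF x] by (intro cSUP_const) blast
    finally show ?thesis by (simp add: quotient_space_def)
  qed
qed

lemma quotient_module:
  assumes U: "LinearCombinations.submodule R U M"
  shows "module R (quotient_space M U)"
proof -
  interpret U: LinearCombinations.submodule R U M by (rule U)
  interpret S: abelian_subgroup U M by (rule submodule_abelian_subgroup[OF U])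
  have zz: "U +>\<^bsub>M\<^esub> \<zero>\<^bsub>M\<^esub> = U"
    using M.a_coset_join2[OF _ S.a_subgroup U.zero_closed] by simp
  note q = quotient_simps[OF U]
  show ?thesis
  proof (rule module_criteria)
    show "cring R" ..
    show "\<zero>\<^bsub>quotient_space M U\<^esub> \<in> carrier (quotient_space M U)"
      unfolding q using zz by (metis M.zero_closed imageI)
    show "\<forall>v\<in>carrier (quotient_space M U). \<exists>neg_v\<in>carrier (quotient_space M U).
        v \<oplus>\<^bsub>quotient_space M U\<^esub> neg_v = \<zero>\<^bsub>quotient_space M U\<^esub>"
    proof
      fix v assume "v \<in> carrier (quotient_space M U)"
      then obtain x where x: "x \<in> carrier M" "v = U +>\<^bsub>M\<^esub> x" by (auto simp: q)
      have "v \<oplus>\<^bsub>quotient_space M U\<^esub> (U +>\<^bsub>M\<^esub> (\<ominus>\<^bsub>M\<^esub> x)) = \<zero>\<^bsub>quotient_space M U\<^esub>"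
        using x zz by (simp add: q M.r_neg)
      then show "\<exists>neg_v\<in>carrier (quotient_space M U). v \<oplus>\<^bsub>quotient_space M U\<^esub> neg_v = \<zero>\<^bsub>quotient_space M U\<^esub>"
        using x by (auto simp: q(1))
    qed
    show "\<forall>v\<in>carrier (quotient_space M U). v \<oplus>\<^bsub>quotient_space M U\<^esub> \<zero>\<^bsub>quotient_space M U\<^esub> = v"
    proof
      fix v assume "v \<in> carrier (quotient_space M U)"
      then obtain x where x: "x \<in> carrier M" "v = U +>\<^bsub>M\<^esub> x" by (auto simp: q)
      have "v \<oplus>\<^bsub>quotient_space M U\<^esub> (U +>\<^bsub>M\<^esub> \<zero>\<^bsub>M\<^esub>) = v"
        using x by (simp add: q)
      then show "v \<oplus>\<^bsub>quotient_space M U\<^esub> \<zero>\<^bsub>quotient_space M U\<^esub> = v" using zz by (simp add: q)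
    qed
    show "\<forall>v w. v \<in> carrier (quotient_space M U) \<and> w \<in> carrier (quotient_space M U) \<longrightarrow>
        v \<oplus>\<^bsub>quotient_space M U\<^esub> w = w \<oplus>\<^bsub>quotient_space M U\<^esub> v"
    proof (intro allI impI)
      fix v w assume "v \<in> carrier (quotient_space M U) \<and> w \<in> carrier (quotient_space M U)"
      then obtain x y where "x \<in> carrier M" "v = U +>\<^bsub>M\<^esub> x" "y \<in> carrier M" "w = U +>\<^bsub>M\<^esub> y"
        by (auto simp: q(1))
      then show "v \<oplus>\<^bsub>quotient_space M U\<^esub> w = w \<oplus>\<^bsub>quotient_space M U\<^esub> v"
        using M.a_comm[of x y] by (simp add: q)
    qed
  qed (auto simp: q smult_l_distr smult_r_distr smult_assoc1 M.a_assoc)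
qed

lemma quotient_proj_hom:
  assumes U: "LinearCombinations.submodule R U M"
  shows "(\<lambda>x. U +>\<^bsub>M\<^esub> x) \<in> module_hom R M (quotient_space M U)"
  by (auto simp: module_hom_def quotient_simps[OF U])

lemma quotient_lift:
  assumes U: "LinearCombinations.submodule R U M" and P: "module R P"
    and g: "g \<in> module_hom R M P" and gU: "\<And>u. u \<in> U \<Longrightarrow> g u = \<zero>\<^bsub>P\<^esub>"
  shows "\<exists>L. L \<in> module_hom R (quotient_space M U) P \<and> (\<forall>x\<in>carrier M. L (U +>\<^bsub>M\<^esub> x) = g x)"
proof -
  interpret U: LinearCombinations.submodule R U M by (rule U)
  interpret S: abelian_subgroup U M by (rule submodule_abelian_subgroup[OF U])
  interpret P: module R P by (rule P)
  note q = quotient_simps[OF U]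
  define L where "L X = g (SOME x. x \<in> X)" for X
  have L: "L (U +>\<^bsub>M\<^esub> x) = g x" if x: "x \<in> carrier M" for x
  proof -
    have "(SOME y. y \<in> U +>\<^bsub>M\<^esub> x) \<in> U +>\<^bsub>M\<^esub> x"
      by (rule someI[of _ x]) (rule S.a_rcos_self[OF x])
    then obtain u where u: "u \<in> U" "(SOME y. y \<in> U +>\<^bsub>M\<^esub> x) = u \<oplus>\<^bsub>M\<^esub> x"
      by (auto simp: a_r_coset_def')
    then have "L (U +>\<^bsub>M\<^esub> x) = g u \<oplus>\<^bsub>P\<^esub> g x"
      using x U.subset by (auto simp: L_def module_hom_add[OF g])
    moreover have "g x \<in> carrier P" using module_hom_closed[OF g] x by auto
    ultimately show ?thesis using gU[OF u(1)] by (simp add: P.M.l_zero)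
  qed
  have "L \<in> module_hom R (quotient_space M U) P"
    unfolding module_hom_def using module_hom_closed[OF g]
    by (auto simp: q L module_hom_add[OF g] module_hom_smult[OF g])
  then show ?thesis using L by blast
qed

end


subsection \<open>The tensor product and its universal property\<close>

lemma tensor_relators_closed:
  assumes "module K V" "module K W"
  shows "tensor_relators K V W \<subseteq> carrier (tensor_free K V W)"
proof -
  interpret V: module K V by fact
  interpret W: module K W by fact
  interpret F: module K "tensor_free K V W"
    unfolding tensor_free_def by (rule V.R.free_space_module)
  have g: "free_gen K (carrier V \<times> carrier W) p \<in> carrier (tensor_free K V W)" for p
    unfolding tensor_free_def by (rule V.R.free_gen_closed)
  show ?thesis
    unfolding tensor_relators_def Let_def
    by (auto intro!: F.M.minus_closed F.M.a_closed F.smult_closed g)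
qed

lemma tensor_null_submodule:
  assumes "module K V" "module K W"
  shows "LinearCombinations.submodule K (tensor_null K V W) (tensor_free K V W)"
proof -
  interpret V: module K V by fact
  interpret F: module K "tensor_free K V W"
    unfolding tensor_free_def by (rule V.R.free_space_module)
  show ?thesis
    unfolding tensor_null_def by (rule F.span_is_submodule[OF tensor_relators_closed[OF assms]])
qed

lemma tensor_module:
  assumes "module K V" "module K W"
  shows "module K (tensor K V W)"
proof -
  interpret V: module K V by fact
  interpret F: module K "tensor_free K V W"
    unfolding tensor_free_def by (rule V.R.free_space_module)
  show ?thesis
    unfolding tensor_def by (rule F.quotient_module[OF tensor_null_submodule[OF assms]])
qed

lemma tensor_vectorspace:
  assumes "vectorspace K V" "vectorspace K W"
  shows "vectorspace K (tensor K V W)"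
  using assms tensor_module unfolding vectorspace_def by blast

lemma tens_bilinear:
  assumes "module K V" "module K W"
  shows "bilinear_map K V W (tensor K V W) (tens K V W)"
proof -
  let ?F = "tensor_free K V W" and ?N = "tensor_null K V W" and ?T = "tensor K V W"
  let ?g = "free_gen K (carrier V \<times> carrier W)"
  interpret V: module K V by fact
  interpret W: module K W by fact
  interpret F: module K ?F
    unfolding tensor_free_def by (rule V.R.free_space_module)
  interpret T: module K ?T by (rule tensor_module[OF assms])
  note N = tensor_null_submodule[OF assms]
  interpret N: LinearCombinations.submodule K ?N ?F by (rule N)
  interpret S: abelian_subgroup ?N ?F by (rule F.submodule_abelian_subgroup[OF N])
  note q = F.quotient_simps[OF N, folded tensor_def]
  have g: "?g p \<in> carrier ?F" for p
    unfolding tensor_free_def by (rule V.R.free_gen_closed)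
  have rel: "tensor_relators K V W \<subseteq> ?N"
    unfolding tensor_null_def by (rule F.in_own_span[OF tensor_relators_closed[OF assms]])
  have eq: "?N +>\<^bsub>?F\<^esub> x = ?N +>\<^bsub>?F\<^esub> y"
    if "x \<ominus>\<^bsub>?F\<^esub> y \<in> tensor_relators K V W" "x \<in> carrier ?F" "y \<in> carrier ?F" for x y
  proof -
    have "x = (x \<ominus>\<^bsub>?F\<^esub> y) \<oplus>\<^bsub>?F\<^esub> y" using that by (simp add: F.M.minus_eq F.M.a_assoc F.M.l_neg)
    then have "x \<in> ?N +>\<^bsub>?F\<^esub> y" using that(1) rel by (auto simp: a_r_coset_def')
    then show ?thesis using that(3) F.M.a_repr_independence[OF _ _ S.a_subgroup] by simp
  qed
  have cl: "tens K V W v w \<in> carrier ?T" for v w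
    unfolding tens_def q by (rule imageI) (rule g)
  have "tens K V W (v \<oplus>\<^bsub>V\<^esub> v') w = tens K V W v w \<oplus>\<^bsub>?T\<^esub> tens K V W v' w"
    if "v \<in> carrier V" "v' \<in> carrier V" "w \<in> carrier W" for v v' w
    unfolding tens_def q(3)[OF g g]
    by (rule eq[OF _ g F.M.a_closed[OF g g]]) (use that in \<open>unfold tensor_relators_def Let_def, blast\<close>)
  moreover have "tens K V W v (w \<oplus>\<^bsub>W\<^esub> w') = tens K V W v w \<oplus>\<^bsub>?T\<^esub> tens K V W v w'"
    if "v \<in> carrier V" "w \<in> carrier W" "w' \<in> carrier W" for v w w'
    unfolding tens_def q(3)[OF g g]
    by (rule eq[OF _ g F.M.a_closed[OF g g]]) (use that in \<open>unfold tensor_relators_def Let_def, blast\<close>)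
  moreover have "tens K V W (c \<odot>\<^bsub>V\<^esub> v) w = c \<odot>\<^bsub>?T\<^esub> tens K V W v w"
    if "c \<in> carrier K" "v \<in> carrier V" "w \<in> carrier W" for c v w
    unfolding tens_def q(4)[OF that(1) g]
    by (rule eq[OF _ g F.smult_closed[OF that(1) g]]) (use that in \<open>unfold tensor_relators_def Let_def, blast\<close>)
  moreover have "tens K V W v (c \<odot>\<^bsub>W\<^esub> w) = c \<odot>\<^bsub>?T\<^esub> tens K V W v w"
    if "c \<in> carrier K" "v \<in> carrier V" "w \<in> carrier W" for c v w
    unfolding tens_def q(4)[OF that(1) g]
    by (rule eq[OF _ g F.smult_closed[OF that(1) g]]) (use that in \<open>unfold tensor_relators_def Let_def, blast\<close>)
  ultimately show ?thesis
    unfolding bilinear_map_def module_hom_def using cl by auto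
qed

lemma tens_closed:
  assumes "module K V" "module K W" "v \<in> carrier V" "w \<in> carrier W"
  shows "tens K V W v w \<in> carrier (tensor K V W)"
  using tens_bilinear[OF assms(1,2)] assms(3,4)
  by (auto simp: bilinear_map_def module_hom_def)

lemma tensor_hom_eqI:
  assumes V: "module K V" and W: "module K W" and P: "module K P"
    and L: "L \<in> module_hom K (tensor K V W) P" and L': "L' \<in> module_hom K (tensor K V W) P"
    and eq: "\<And>v w. v \<in> carrier V \<Longrightarrow> w \<in> carrier W \<Longrightarrow> L (tens K V W v w) = L' (tens K V W v w)"
    and X: "X \<in> carrier (tensor K V W)"
  shows "L X = L' X"
proof -
  let ?F = "tensor_free K V W" and ?N = "tensor_null K V W" and ?T = "tensor K V W"
  let ?g = "free_gen K (carrier V \<times> carrier W)"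
  interpret V: module K V by fact
  interpret W: module K W by fact
  interpret P: module K P by fact
  interpret F: module K ?F
    unfolding tensor_free_def by (rule V.R.free_space_module)
  interpret T: module K ?T by (rule tensor_module[OF V W])
  note N = tensor_null_submodule[OF V W]
  note q = F.quotient_simps[OF N, folded tensor_def]
  note pr = F.quotient_proj_hom[OF N, folded tensor_def]
  have g: "?g p \<in> carrier ?F" for p
    unfolding tensor_free_def by (rule V.R.free_gen_closed)
  obtain f where f: "f \<in> carrier ?F" "X = ?N +>\<^bsub>?F\<^esub> f" using X unfolding q(1) by blast
  let ?S = "{p \<in> carrier V \<times> carrier W. f p \<noteq> \<zero>\<^bsub>K\<^esub>}"
  have fc: "f p \<in> carrier K" if "p \<in> carrier V \<times> carrier W" for p
  proof -
    have "f \<in> carrier V \<times> carrier W \<rightarrow>\<^sub>E carrier K"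
      using f(1) by (simp add: tensor_free_def free_space_carrier)
    then show ?thesis using that by (rule PiE_mem)
  qed
  have fe: "f = (\<Oplus>\<^bsub>?F\<^esub>p\<in>?S. f p \<odot>\<^bsub>?F\<^esub> ?g p)"
    using V.R.free_space_expand[OF f(1)[unfolded tensor_free_def]]
    unfolding free_ext_def tensor_free_def .
  have key: "M' X = (\<Oplus>\<^bsub>P\<^esub>p\<in>?S. f p \<odot>\<^bsub>P\<^esub> M' (tens K V W (fst p) (snd p)))"
    if M': "M' \<in> module_hom K ?T P" for M'
  proof -
    interpret h: mod_hom K ?F P "\<lambda>x. M' (?N +>\<^bsub>?F\<^esub> x)"
    proof unfold_locales
      show "(\<lambda>x. M' (?N +>\<^bsub>?F\<^esub> x)) \<in> module_hom K ?F P"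
        using M' pr by (auto simp: module_hom_def Pi_iff)
    qed
    have "M' X = M' (?N +>\<^bsub>?F\<^esub> (\<Oplus>\<^bsub>?F\<^esub>p\<in>?S. f p \<odot>\<^bsub>?F\<^esub> ?g p))"
      unfolding f(2) by (rule arg_cong[OF fe])
    also have "\<dots> = (\<Oplus>\<^bsub>P\<^esub>p\<in>?S. M' (?N +>\<^bsub>?F\<^esub> (f p \<odot>\<^bsub>?F\<^esub> ?g p)))"
    proof -
      have fin: "finite ?S" using f(1) by (simp add: tensor_free_def free_space_carrier)
      have "M' (?N +>\<^bsub>?F\<^esub> (\<Oplus>\<^bsub>?F\<^esub>p\<in>A. f p \<odot>\<^bsub>?F\<^esub> ?g p)) = (\<Oplus>\<^bsub>P\<^esub>p\<in>A. M' (?N +>\<^bsub>?F\<^esub> (f p \<odot>\<^bsub>?F\<^esub> ?g p)))"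
        if "finite A" "A \<subseteq> ?S" for A
        using that
      proof (induction A)
        case empty
        then show ?case using h.f0_is_0 by simp
      next
        case (insert a A)
        have c: "f p \<odot>\<^bsub>?F\<^esub> ?g p \<in> carrier ?F" if "p \<in> insert a A" for p
          using that insert.prems fc g by (intro F.smult_closed) auto
        have c': "M' (?N +>\<^bsub>?F\<^esub> (f p \<odot>\<^bsub>?F\<^esub> ?g p)) \<in> carrier P" if "p \<in> insert a A" for p
          using h.f_im[OF c[OF that]] .
        show ?case
          using insert.hyps insert.IH insert.prems c c'
          by (subst F.M.finsum_insert, blast, blast, blast, blast,
              subst P.M.finsum_insert, blast, blast, blast, blast,
              subst h.f_add, blast, blast intro: F.M.finsum_closed, simp)
      qed
      from this[OF fin] show ?thesis by simp
    qed
    also have "\<dots> = (\<Oplus>\<^bsub>P\<^esub>p\<in>?S. f p \<odot>\<^bsub>P\<^esub> M' (tens K V W (fst p) (snd p)))"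
    proof (rule P.M.finsum_cong')
      have "M' (tens K V W (fst p) (snd p)) \<in> carrier P" if "p \<in> ?S" for p
        using that tens_closed[OF V W] module_hom_closed[OF M'] by (auto simp: Pi_iff)
      then show "(\<lambda>p. f p \<odot>\<^bsub>P\<^esub> M' (tens K V W (fst p) (snd p))) \<in> ?S \<rightarrow> carrier P"
        using fc by (intro Pi_I P.smult_closed) auto
      show "M' (?N +>\<^bsub>?F\<^esub> (f p \<odot>\<^bsub>?F\<^esub> ?g p)) = f p \<odot>\<^bsub>P\<^esub> M' (tens K V W (fst p) (snd p))"
        if "p \<in> ?S" for p
      proof -
        have "(fst p, snd p) = p" by simp
        then show ?thesis
          unfolding tens_def using h.f_smult[OF fc g, of p p] that by simp
      qed
    qed simp
    finally show ?thesis .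
  qed
  have "(\<Oplus>\<^bsub>P\<^esub>p\<in>?S. f p \<odot>\<^bsub>P\<^esub> L (tens K V W (fst p) (snd p)))
      = (\<Oplus>\<^bsub>P\<^esub>p\<in>?S. f p \<odot>\<^bsub>P\<^esub> L' (tens K V W (fst p) (snd p)))"
  proof (rule P.M.finsum_cong')
    have "L' (tens K V W (fst p) (snd p)) \<in> carrier P" if "p \<in> ?S" for p
      using that tens_closed[OF V W] module_hom_closed[OF L'] by (auto simp: Pi_iff)
    then show "(\<lambda>p. f p \<odot>\<^bsub>P\<^esub> L' (tens K V W (fst p) (snd p))) \<in> ?S \<rightarrow> carrier P"
      using fc by (intro Pi_I P.smult_closed) auto
  qed (use eq in auto)
  then show ?thesis unfolding key[OF L] key[OF L'] .
qed

lemma tensor_hom_exists: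
  assumes V: "module K V" and W: "module K W" and P: "module K P"
    and f: "bilinear_map K V W P f"
  shows "\<exists>L. L \<in> module_hom K (tensor K V W) P \<and>
    (\<forall>v\<in>carrier V. \<forall>w\<in>carrier W. L (tens K V W v w) = f v w)"
proof -
  let ?X = "carrier V \<times> carrier W" and ?F = "tensor_free K V W" and ?N = "tensor_null K V W"
  let ?g = "free_gen K ?X"
  interpret V: module K V by fact
  interpret W: module K W by fact
  interpret P: module K P by fact
  interpret F: module K ?F
    unfolding tensor_free_def by (rule V.R.free_space_module)
  note N = tensor_null_submodule[OF V W]
  have g: "?g p \<in> carrier ?F" for p
    unfolding tensor_free_def by (rule V.R.free_gen_closed)
  have fc: "f v w \<in> carrier P" if "v \<in> carrier V" "w \<in> carrier W" for v w
    using f that by (auto simp: bilinear_map_def module_hom_def)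
  have fa: "f (v \<oplus>\<^bsub>V\<^esub> v') w = f v w \<oplus>\<^bsub>P\<^esub> f v' w"
    if "v \<in> carrier V" "v' \<in> carrier V" "w \<in> carrier W" for v v' w
    using f that by (auto simp: bilinear_map_def module_hom_def)
  have fa': "f v (w \<oplus>\<^bsub>W\<^esub> w') = f v w \<oplus>\<^bsub>P\<^esub> f v w'"
    if "v \<in> carrier V" "w \<in> carrier W" "w' \<in> carrier W" for v w w'
    using f that by (auto simp: bilinear_map_def module_hom_def)
  have fs: "f (c \<odot>\<^bsub>V\<^esub> v) w = c \<odot>\<^bsub>P\<^esub> f v w"
    if "c \<in> carrier K" "v \<in> carrier V" "w \<in> carrier W" for c v w
    using f that by (auto simp: bilinear_map_def module_hom_def)
  have fs': "f v (c \<odot>\<^bsub>W\<^esub> w) = c \<odot>\<^bsub>P\<^esub> f v w"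
    if "c \<in> carrier K" "v \<in> carrier V" "w \<in> carrier W" for c v w
    using f that by (auto simp: bilinear_map_def module_hom_def)
  define e where "e = free_ext K ?X P (\<lambda>p. f (fst p) (snd p))"
  have ec: "(\<lambda>p. f (fst p) (snd p)) \<in> ?X \<rightarrow> carrier P" using fc by auto
  have eh: "e \<in> module_hom K ?F P"
    unfolding e_def tensor_free_def by (rule P.free_ext_hom[OF ec])
  interpret e: mod_hom K ?F P e by unfold_locales (rule eh)
  have eg: "e (?g (v, w)) = f v w" if "v \<in> carrier V" "w \<in> carrier W" for v w
    using P.free_ext_gen[OF ec, of "(v, w)"] that by (simp add: e_def)
  have "tensor_relators K V W \<subseteq> e.ker"
    unfolding tensor_relators_def Let_def e.ker_def
    using g by (auto simp: e.f_minus eg fa fa' fs fs' fc P.M.r_neg P.M.minus_eq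
        intro!: F.M.minus_closed F.M.a_closed F.smult_closed)
  then have "?N \<subseteq> e.ker"
    unfolding tensor_null_def by (rule F.span_is_subset) (rule e.ker_is_submodule)
  then have eN: "e u = \<zero>\<^bsub>P\<^esub>" if "u \<in> ?N" for u
    using that by (auto simp: e.ker_def)
  obtain L where L: "L \<in> module_hom K (tensor K V W) P" "\<And>x. x \<in> carrier ?F \<Longrightarrow> L (?N +>\<^bsub>?F\<^esub> x) = e x"
    using F.quotient_lift[OF N P eh eN] unfolding tensor_def by blast
  have "L (tens K V W v w) = f v w" if "v \<in> carrier V" "w \<in> carrier W" for v w
    unfolding tens_def by (simp add: L(2) g eg that)
  then show ?thesis using L(1) by blast
qed

theorem tensor_universal:
  assumes V: "vectorspace K V" and W: "vectorspace K W" and P: "vectorspace K P"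
    and f: "bilinear_map K V W P f"
  shows "\<exists>!L. L \<in> extensional (carrier (tensor K V W)) \<and> linear_map K (tensor K V W) P L \<and>
              (\<forall>v\<in>carrier V. \<forall>w\<in>carrier W. L (tens K V W v w) = f v w)"
proof -
  let ?T = "tensor K V W"
  have Vm: "module K V" and Wm: "module K W" and Pm: "module K P"
    using V W P by (auto simp: vectorspace_def)
  have T: "vectorspace K ?T" by (rule tensor_vectorspace[OF V W])
  have lin: "linear_map K ?T P L \<longleftrightarrow> L \<in> module_hom K ?T P" for L
    using T P by (auto simp: linear_map_def mod_hom_def mod_hom_axioms_def vectorspace_def)
  interpret T: vectorspace K ?T by (rule T)
  obtain L where L: "L \<in> module_hom K ?T P"
      "\<And>v w. v \<in> carrier V \<Longrightarrow> w \<in> carrier W \<Longrightarrow> L (tens K V W v w) = f v w"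
    using tensor_hom_exists[OF Vm Wm Pm f] by blast
  show ?thesis
  proof (rule ex1I[of _ "restrict L (carrier ?T)"], intro conjI ballI)
    show "linear_map K ?T P (restrict L (carrier ?T))"
      using L(1) by (auto simp: lin module_hom_def)
    show "restrict L (carrier ?T) (tens K V W v w) = f v w" if "v \<in> carrier V" "w \<in> carrier W" for v w
      using that L(2) tens_closed[OF Vm Wm] by simp
  next
    fix L' assume L': "L' \<in> extensional (carrier ?T) \<and> linear_map K ?T P L' \<and>
      (\<forall>v\<in>carrier V. \<forall>w\<in>carrier W. L' (tens K V W v w) = f v w)"
    show "L' = restrict L (carrier ?T)"
    proof (rule extensionalityI[of _ "carrier ?T"])
      fix X assume X: "X \<in> carrier ?T"
      have "L' X = L X"
        by (rule tensor_hom_eqI[OF Vm Wm Pm _ L(1) _ X]) (use L' L(2) in \<open>auto simp: lin\<close>)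
      then show "L' X = restrict L (carrier ?T) X" using X by simp
    qed (use L' in auto)
  qed simp
qed

lemma
  assumes "vectorspace K V" "vectorspace K W" "vectorspace K P" "bilinear_map K V W P f"
  shows tensor_lift_extensional: "tensor_lift K V W P f \<in> extensional (carrier (tensor K V W))"
    and tensor_lift_linear: "linear_map K (tensor K V W) P (tensor_lift K V W P f)"
    and tensor_lift_tens: "\<lbrakk>v \<in> carrier V; w \<in> carrier W\<rbrakk> \<Longrightarrow>
      tensor_lift K V W P f (tens K V W v w) = f v w"
  using theI'[OF tensor_universal[OF assms]] unfolding tensor_lift_def by blast+


subsection \<open>Induced maps\<close>

text \<open>\<open>f \<otimes> g : V \<otimes> W \<rightarrow> V' \<otimes> W'\<close> for linear maps \<open>f : V \<rightarrow> V'\<close> and \<open>g : W \<rightarrow> W'\<close>.\<close>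

definition tensor_map ::
    "('k, 'r) ring_scheme \<Rightarrow> ('k, 'v, 'x1) module_scheme \<Rightarrow> ('k, 'w, 'x2) module_scheme
      \<Rightarrow> ('k, 'v1, 'x3) module_scheme \<Rightarrow> ('k, 'w1, 'x4) module_scheme
      \<Rightarrow> ('v \<Rightarrow> 'v1) \<Rightarrow> ('w \<Rightarrow> 'w1) \<Rightarrow> ('v \<times> 'w \<Rightarrow> 'k) set \<Rightarrow> ('v1 \<times> 'w1 \<Rightarrow> 'k) set" where
  "tensor_map K V W V' W' f g =
     tensor_lift K V W (tensor K V' W') (\<lambda>v w. tens K V' W' (f v) (g w))"

definition tensor_flip ::
    "('k, 'r) ring_scheme \<Rightarrow> ('k, 'v, 'x1) module_scheme \<Rightarrow> ('k, 'w, 'x2) module_scheme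
      \<Rightarrow> ('v \<times> 'w \<Rightarrow> 'k) set \<Rightarrow> ('w \<times> 'v \<Rightarrow> 'k) set" where
  "tensor_flip K V W = tensor_lift K V W (tensor K W V) (\<lambda>v w. tens K W V w v)"

text \<open>
  The associativity isomorphisms \<open>(U \<otimes> V) \<otimes> W \<rightarrow> U \<otimes> (V \<otimes> W)\<close> and back, which are
  usually suppressed.
\<close>

definition tensor_assoc ::
    "('k, 'r) ring_scheme \<Rightarrow> ('k, 'u, 'x1) module_scheme \<Rightarrow> ('k, 'v, 'x2) module_scheme
      \<Rightarrow> ('k, 'w, 'x3) module_scheme
      \<Rightarrow> (('u \<times> 'v \<Rightarrow> 'k) set \<times> 'w \<Rightarrow> 'k) set \<Rightarrow> ('u \<times> ('v \<times> 'w \<Rightarrow> 'k) set \<Rightarrow> 'k) set" where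
  "tensor_assoc K U V W =
     tensor_lift K (tensor K U V) W (tensor K U (tensor K V W))
       (\<lambda>x w. tensor_lift K U V (tensor K U (tensor K V W))
                (\<lambda>u v. tens K U (tensor K V W) u (tens K V W v w)) x)"

definition tensor_assoc_inv ::
    "('k, 'r) ring_scheme \<Rightarrow> ('k, 'u, 'x1) module_scheme \<Rightarrow> ('k, 'v, 'x2) module_scheme
      \<Rightarrow> ('k, 'w, 'x3) module_scheme
      \<Rightarrow> ('u \<times> ('v \<times> 'w \<Rightarrow> 'k) set \<Rightarrow> 'k) set \<Rightarrow> (('u \<times> 'v \<Rightarrow> 'k) set \<times> 'w \<Rightarrow> 'k) set" where
  "tensor_assoc_inv K U V W =
     tensor_lift K U (tensor K V W) (tensor K (tensor K U V) W)
       (\<lambda>u y. tensor_lift K V W (tensor K (tensor K U V) W)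
                (\<lambda>v w. tens K (tensor K U V) W (tens K U V u v) w) y)"


section \<open>Hom-associative algebras, hom-coassociative coalgebras, hom-bialgebras\<close>

text \<open>A multiplication is a linear map \<open>m : A \<otimes> A \<rightarrow> A\<close>; the product of \<open>a\<close> and \<open>b\<close> is
  \<open>m (tens K A A a b)\<close>.\<close>

locale hom_assoc_algebra = vectorspace K A
    for K :: "('k, 'r) ring_scheme" and A :: "('k, 'a, 'x) module_scheme" (structure) +
  fixes m :: "('a \<times> 'a \<Rightarrow> 'k) set \<Rightarrow> 'a" and \<alpha> :: "'a \<Rightarrow> 'a"
  assumes mult_linear: "linear_map K (tensor K A A) A m"
    and twist_linear: "linear_map K A A \<alpha>"
    and twist_mult: "\<lbrakk>a \<in> carrier A; b \<in> carrier A\<rbrakk> \<Longrightarrow>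
      \<alpha> (m (tens K A A a b)) = m (tens K A A (\<alpha> a) (\<alpha> b))"
    and hom_assoc: "\<lbrakk>a \<in> carrier A; b \<in> carrier A; c \<in> carrier A\<rbrakk> \<Longrightarrow>
      m (tens K A A (\<alpha> a) (m (tens K A A b c))) = m (tens K A A (m (tens K A A a b)) (\<alpha> c))"

text \<open>The componentwise multiplication on \<open>A \<otimes> A\<close>:
  \<open>(a \<otimes> b) (a' \<otimes> b') = a a' \<otimes> b b'\<close>.\<close>

definition tensor_mult ::
    "('k, 'r) ring_scheme \<Rightarrow> ('k, 'a, 'x) module_scheme \<Rightarrow> (('a \<times> 'a \<Rightarrow> 'k) set \<Rightarrow> 'a)
      \<Rightarrow> (('a \<times> 'a \<Rightarrow> 'k) set \<times> ('a \<times> 'a \<Rightarrow> 'k) set \<Rightarrow> 'k) set \<Rightarrow> ('a \<times> 'a \<Rightarrow> 'k) set" where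
  "tensor_mult K A m =
     tensor_lift K (tensor K A A) (tensor K A A) (tensor K A A)
       (\<lambda>x y. tensor_lift K A A (tensor K A A)
          (\<lambda>a b. tensor_lift K A A (tensor K A A)
             (\<lambda>a' b'. tens K A A (m (tens K A A a a')) (m (tens K A A b b'))) y) x)"

definition hom_alg_morphism ::
    "('k, 'r) ring_scheme
      \<Rightarrow> ('k, 'a, 'x) module_scheme \<Rightarrow> (('a \<times> 'a \<Rightarrow> 'k) set \<Rightarrow> 'a) \<Rightarrow> ('a \<Rightarrow> 'a)
      \<Rightarrow> ('k, 'b, 'y) module_scheme \<Rightarrow> (('b \<times> 'b \<Rightarrow> 'k) set \<Rightarrow> 'b) \<Rightarrow> ('b \<Rightarrow> 'b)
      \<Rightarrow> ('a \<Rightarrow> 'b) \<Rightarrow> bool" where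
  "hom_alg_morphism K A m\<^sub>A \<alpha>\<^sub>A B m\<^sub>B \<alpha>\<^sub>B f \<longleftrightarrow>
     linear_map K A B f \<and>
     (\<forall>a\<in>carrier A. \<forall>a'\<in>carrier A. f (m\<^sub>A (tens K A A a a')) = m\<^sub>B (tens K B B (f a) (f a'))) \<and>
     (\<forall>a\<in>carrier A. f (\<alpha>\<^sub>A a) = \<alpha>\<^sub>B (f a))"

locale hom_coassoc_coalgebra = vectorspace K C
    for K :: "('k, 'r) ring_scheme" and C :: "('k, 'c, 'x) module_scheme" (structure) +
  fixes \<Delta> :: "'c \<Rightarrow> ('c \<times> 'c \<Rightarrow> 'k) set" and \<psi> :: "'c \<Rightarrow> 'c"
  assumes comult_linear: "linear_map K C (tensor K C C) \<Delta>"
    and cotwist_linear: "linear_map K C C \<psi>"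
    and cotwist_comult: "c \<in> carrier C \<Longrightarrow> tensor_map K C C C C \<psi> \<psi> (\<Delta> c) = \<Delta> (\<psi> c)"
    and hom_coassoc: "c \<in> carrier C \<Longrightarrow>
      tensor_assoc K C C C (tensor_map K C C (tensor K C C) C \<Delta> \<psi> (\<Delta> c)) =
      tensor_map K C C C (tensor K C C) \<psi> \<Delta> (\<Delta> c)"

definition hom_coalg_morphism ::
    "('k, 'r) ring_scheme
      \<Rightarrow> ('k, 'c, 'x) module_scheme \<Rightarrow> ('c \<Rightarrow> ('c \<times> 'c \<Rightarrow> 'k) set) \<Rightarrow> ('c \<Rightarrow> 'c)
      \<Rightarrow> ('k, 'd, 'y) module_scheme \<Rightarrow> ('d \<Rightarrow> ('d \<times> 'd \<Rightarrow> 'k) set) \<Rightarrow> ('d \<Rightarrow> 'd)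
      \<Rightarrow> ('c \<Rightarrow> 'd) \<Rightarrow> bool" where
  "hom_coalg_morphism K C \<Delta>\<^sub>C \<psi>\<^sub>C D \<Delta>\<^sub>D \<psi>\<^sub>D f \<longleftrightarrow>
     linear_map K C D f \<and>
     (\<forall>c\<in>carrier C. tensor_map K C C D D f f (\<Delta>\<^sub>C c) = \<Delta>\<^sub>D (f c)) \<and>
     (\<forall>c\<in>carrier C. f (\<psi>\<^sub>C c) = \<psi>\<^sub>D (f c))"

locale hom_bialgebra =
  hom_assoc_algebra K H m \<alpha> + hom_coassoc_coalgebra K H \<Delta> \<psi>
    for K :: "('k, 'r) ring_scheme" and H :: "('k, 'h, 'x) module_scheme" (structure) and m \<Delta> \<alpha> \<psi> +
  assumes comult_morphism: "hom_alg_morphism K H m \<alpha>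
      (tensor K H H) (tensor_mult K H m) (tensor_map K H H H H \<alpha> \<alpha>) \<Delta>"
    and cotwist_morphism: "hom_alg_morphism K H m \<alpha> H m \<alpha> \<psi>"
    and twist_comorphism: "hom_coalg_morphism K H \<Delta> \<psi> H \<Delta> \<psi> \<alpha>"

text \<open>
  The element \<open>R\<close> comes with a presentation \<open>R = \<Sum>\<^sub>i s\<^sub>i \<otimes> t\<^sub>i\<close>, \<open>i < n\<close>; every element of
  \<open>H \<otimes> H\<close> has one, and the right-hand sides below do not depend on its choice.
\<close>

locale quasitriangular_hom_bialgebra = hom_bialgebra K H m \<Delta> \<alpha> \<psi>
    for K :: "('k, 'r) ring_scheme" and H :: "('k, 'h, 'x) module_scheme" (structure) and m \<Delta> \<alpha> \<psi> +
  fixes R :: "('h \<times> 'h \<Rightarrow> 'k) set" and n :: nat and s t :: "nat \<Rightarrow> 'h"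
  assumes s_closed: "i < n \<Longrightarrow> s i \<in> carrier H"
    and t_closed: "i < n \<Longrightarrow> t i \<in> carrier H"
    and R_eq: "R = (\<Oplus>\<^bsub>tensor K H H\<^esub>i\<in>{..<n}. tens K H H (s i) (t i))"
    and R_comult: "h \<in> carrier H \<Longrightarrow>
      tensor_mult K H m (tens K (tensor K H H) (tensor K H H) R (\<Delta> h)) =
      tensor_mult K H m (tens K (tensor K H H) (tensor K H H) (tensor_flip K H H (\<Delta> h)) R)"
    and comult_R_left:
      "tensor_map K H H (tensor K H H) H \<Delta> \<alpha> R =
       (\<Oplus>\<^bsub>tensor K (tensor K H H) H\<^esub>i\<in>{..<n}. \<Oplus>\<^bsub>tensor K (tensor K H H) H\<^esub>j\<in>{..<n}.
          tens K (tensor K H H) H (tens K H H (\<psi> (s i)) (\<psi> (s j))) (m (tens K H H (t i) (t j))))"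
    and comult_R_right:
      "tensor_map K H H H (tensor K H H) \<alpha> \<Delta> R =
       (\<Oplus>\<^bsub>tensor K H (tensor K H H)\<^esub>i\<in>{..<n}. \<Oplus>\<^bsub>tensor K H (tensor K H H)\<^esub>j\<in>{..<n}.
          tens K H (tensor K H H) (m (tens K H H (s i) (s j))) (tens K H H (\<psi> (t j)) (\<psi> (t i))))"


section \<open>Modules and the hom-Yang-Baxter equation\<close>

locale left_hom_module = hom_assoc_algebra K H m \<alpha> + M?: vectorspace K M
    for K :: "('k, 'r) ring_scheme" and H :: "('k, 'h, 'x) module_scheme" (structure) and m \<alpha>
    and M :: "('k, 'm, 'y) module_scheme" (structure) +
  fixes \<alpha>\<^sub>M :: "'m \<Rightarrow> 'm" and act :: "('h \<times> 'm \<Rightarrow> 'k) set \<Rightarrow> 'm"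
  assumes module_twist_linear: "linear_map K M M \<alpha>\<^sub>M"
    and act_linear: "linear_map K (tensor K H M) M act"
    and twist_act: "\<lbrakk>h \<in> carrier H; x \<in> carrier M\<rbrakk> \<Longrightarrow>
      \<alpha>\<^sub>M (act (tens K H M h x)) = act (tens K H M (\<alpha> h) (\<alpha>\<^sub>M x))"
    and act_act: "\<lbrakk>h \<in> carrier H; h' \<in> carrier H; x \<in> carrier M\<rbrakk> \<Longrightarrow>
      act (tens K H M (\<alpha> h) (act (tens K H M h' x))) =
      act (tens K H M (m (tens K H H h h')) (\<alpha>\<^sub>M x))"

text \<open>The equation is stated on \<open>(V \<otimes> V) \<otimes> V\<close>: \<open>\<alpha>\<^sub>V \<otimes> d\<close>, which acts on \<open>V \<otimes> (V \<otimes> V)\<close>, is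
  conjugated with the associativity isomorphism.\<close>

definition hom_yang_baxter ::
    "('k, 'r) ring_scheme \<Rightarrow> ('k, 'v, 'x) module_scheme \<Rightarrow> ('v \<Rightarrow> 'v)
      \<Rightarrow> (('v \<times> 'v \<Rightarrow> 'k) set \<Rightarrow> ('v \<times> 'v \<Rightarrow> 'k) set) \<Rightarrow> bool" where
  "hom_yang_baxter K V \<alpha>\<^sub>V d \<longleftrightarrow>
     vectorspace K V \<and> linear_map K V V \<alpha>\<^sub>V \<and>
     linear_map K (tensor K V V) (tensor K V V) d \<and>
     (\<forall>x\<in>carrier (tensor K V V).
        tensor_map K V V V V \<alpha>\<^sub>V \<alpha>\<^sub>V (d x) = d (tensor_map K V V V V \<alpha>\<^sub>V \<alpha>\<^sub>V x)) \<and>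
     (let d\<alpha> = tensor_map K (tensor K V V) V (tensor K V V) V d \<alpha>\<^sub>V;
          \<alpha>d = (\<lambda>x. tensor_assoc_inv K V V V
                 (tensor_map K V (tensor K V V) V (tensor K V V) \<alpha>\<^sub>V d (tensor_assoc K V V V x)))
      in \<forall>x\<in>carrier (tensor K (tensor K V V) V). d\<alpha> (\<alpha>d (d\<alpha> x)) = \<alpha>d (d\<alpha> (\<alpha>d x)))"

end

theory Submission
  imports Defs
begin

text \<open>
  Write \<open>R\<^sub>i = s\<^sub>i \<otimes> t\<^sub>i\<close> for the terms of \<open>R\<close>, suppressing the sums. Evaluating both sides of the
  equation on \<open>x \<otimes> y \<otimes> z\<close>, and moving all actions together with the module axioms, gives
    \<open>t\<^sub>kt\<^sub>j \<cdot> z'' \<otimes> s\<^sub>kt\<^sub>i \<cdot> y'' \<otimes> s\<^sub>js\<^sub>i \<cdot> x''\<close>  and  \<open>t\<^sub>jt\<^sub>i \<cdot> z'' \<otimes> t\<^sub>ks\<^sub>i \<cdot> y'' \<otimes> s\<^sub>ks\<^sub>j \<cdot> x''\<close>,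
  where \<open>x'' = \<alpha>\<^sub>M (\<alpha>\<^sub>M x)\<close> etc. The module axiom \<open>\<alpha> h \<cdot> (h' \<cdot> x) = (h h') \<cdot> \<alpha>\<^sub>M x\<close> needs a twist on the
  outer element, and these twists are free: \<open>(\<alpha> \<otimes> \<alpha>) R = R\<close> lets every occurrence of \<open>(s\<^sub>i, t\<^sub>i)\<close> inside a
  bilinear expression be replaced by \<open>(\<alpha> s\<^sub>i, \<alpha> t\<^sub>i)\<close> (lemma \<open>twist_sum\<close>).

  It remains to prove a Yang--Baxter equation for \<open>R\<close> itself in \<open>H \<otimes> H \<otimes> H\<close>
  (lemma \<open>quantum_yang_baxter\<close>). Apart from \<open>R\<^sub>i\<close>, the first expression only
  involves \<open>s\<^sub>k \<otimes> s\<^sub>j \<otimes> t\<^sub>kt\<^sub>j\<close>; apart from \<open>R\<^sub>k\<close>, the second only involves \<open>s\<^sub>j \<otimes> s\<^sub>i \<otimes> t\<^sub>jt\<^sub>i\<close>; up to the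
  names of the indices these are the same element. The axiom for
  \<open>(\<Delta> \<otimes> \<alpha>) R\<close>, after twisting by \<open>\<psi>\<close> (which is multiplicative and fixes \<open>R\<close>), rewrites it as
  \<open>\<Delta> (s\<^sub>l) \<otimes> \<psi> (\<alpha> t\<^sub>l)\<close> (lemma \<open>comult_sum\<close>). In these terms the two sides of the equation are
  \<open>\<Delta>\<^sup>c\<^sup>o\<^sup>p(s\<^sub>l) R\<close> and \<open>R \<Delta>(s\<^sub>l)\<close>, each paired with \<open>\<psi> (\<alpha> t\<^sub>l)\<close>, and so they agree by the intertwining
  property of \<open>R\<close>.
\<close>

section \<open>Linear maps and finite sums\<close>

lemma linear_map_iff_module_hom:
  assumes "vectorspace K V" "vectorspace K W"
  shows "linear_map K V W f \<longleftrightarrow> f \<in> module_hom K V W"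
  using assms by (auto simp: linear_map_def mod_hom_def mod_hom_axioms_def vectorspace_def)

lemma vectorspace_module: "vectorspace K V \<Longrightarrow> module K V"
  by (simp add: vectorspace_def)

lemma module_hom_app: "f \<in> module_hom K V W \<Longrightarrow> v \<in> carrier V \<Longrightarrow> f v \<in> carrier W"
  by (auto simp: module_hom_def)

lemma tens_in: "vectorspace K V \<Longrightarrow> vectorspace K W \<Longrightarrow> v \<in> carrier V \<Longrightarrow> w \<in> carrier W \<Longrightarrow>
   tens K V W v w \<in> carrier (tensor K V W)"
  by (intro tens_closed vectorspace_module)

lemma finsum_in: "vectorspace K V \<Longrightarrow> (\<And>i. i \<in> A \<Longrightarrow> f i \<in> carrier V) \<Longrightarrow> finsum V f A \<in> carrier V"
proof -
  assume V: "vectorspace K V" and f: "\<And>i. i \<in> A \<Longrightarrow> f i \<in> carrier V"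
  interpret V: vectorspace K V by fact
  show ?thesis using f by (intro V.M.finsum_closed) auto
qed

lemma finsum_cong_in:
  assumes V: "vectorspace K V" and g: "\<And>i. i \<in> A \<Longrightarrow> g i \<in> carrier V"
    and eq: "\<And>i. i \<in> A \<Longrightarrow> f i = g i"
  shows "finsum V f A = finsum V g A"
proof -
  interpret V: vectorspace K V by fact
  show ?thesis using g eq by (intro V.M.finsum_cong') auto
qed

lemma finsum_swap:
  assumes P: "vectorspace K P" and A: "finite A" and B: "finite B"
    and f: "\<And>i j. i \<in> A \<Longrightarrow> j \<in> B \<Longrightarrow> f i j \<in> carrier P"
  shows "(\<Oplus>\<^bsub>P\<^esub>i\<in>A. \<Oplus>\<^bsub>P\<^esub>j\<in>B. f i j) = (\<Oplus>\<^bsub>P\<^esub>j\<in>B. \<Oplus>\<^bsub>P\<^esub>i\<in>A. f i j)"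
proof -
  interpret P: vectorspace K P by fact
  show ?thesis using P.M.add.finprod_finprod_swap[of A B f] A B f by (simp add: finsum_def)
qed

lemma module_hom_id: "(\<lambda>v. v) \<in> module_hom K V V"
  by (auto simp: module_hom_def)

lemma module_hom_comp:
  "g \<in> module_hom K V W \<Longrightarrow> f \<in> module_hom K U V \<Longrightarrow> (\<lambda>u. g (f u)) \<in> module_hom K U W"
  by (auto simp: module_hom_def Pi_iff)

lemma module_hom_plus:
  assumes P: "vectorspace K P" and f: "f \<in> module_hom K U P" and g: "g \<in> module_hom K U P"
  shows "(\<lambda>u. f u \<oplus>\<^bsub>P\<^esub> g u) \<in> module_hom K U P"
proof -
  interpret P: vectorspace K P by fact
  note cl = module_hom_app[OF f] module_hom_app[OF g]
  show ?thesis unfolding module_hom_def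
    by (auto simp: cl module_hom_add[OF f] module_hom_add[OF g] module_hom_smult[OF f] module_hom_smult[OF g]
      P.smult_r_distr P.M.a_ac)
qed

lemma module_hom_scale:
  assumes P: "vectorspace K P" and f: "f \<in> module_hom K U P" and c: "c \<in> carrier K"
  shows "(\<lambda>u. c \<odot>\<^bsub>P\<^esub> f u) \<in> module_hom K U P"
proof -
  interpret P: vectorspace K P by fact
  note cl = module_hom_app[OF f]
  have "c \<odot>\<^bsub>P\<^esub> (d \<odot>\<^bsub>P\<^esub> x) = d \<odot>\<^bsub>P\<^esub> (c \<odot>\<^bsub>P\<^esub> x)" if "d \<in> carrier K" "x \<in> carrier P" for d x
    using that c by (metis P.smult_assoc1 P.R.m_comm)
  then show ?thesis unfolding module_hom_def
    by (auto simp: c cl module_hom_add[OF f] module_hom_smult[OF f] P.smult_r_distr)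
qed

lemma module_hom_zero_at:
  assumes "vectorspace K U" "vectorspace K P" "f \<in> module_hom K U P"
  shows "f \<zero>\<^bsub>U\<^esub> = \<zero>\<^bsub>P\<^esub>"
proof -
  interpret linear_map K U P f using linear_map_iff_module_hom[OF assms(1,2)] assms(3) by blast
  show ?thesis by (rule f0_is_0)
qed

lemma module_hom_finsum_apply:
  assumes U: "vectorspace K U" and P: "vectorspace K P" and L: "L \<in> module_hom K U P"
    and fin: "finite A" and f: "\<And>i. i \<in> A \<Longrightarrow> f i \<in> carrier U"
  shows "L (finsum U f A) = finsum P (\<lambda>i. L (f i)) A"
  using fin f
proof (induction A)
  interpret U: vectorspace K U by fact
  interpret P: vectorspace K P by fact
  case empty then show ?case using module_hom_zero_at[OF U P L] by simp
next
  interpret U: vectorspace K U by fact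
  interpret P: vectorspace K P by fact
  case (insert a A)
  have "f \<in> A \<rightarrow> carrier U" "f a \<in> carrier U" "(\<lambda>i. L (f i)) \<in> A \<rightarrow> carrier P" "L (f a) \<in> carrier P"
    using insert.prems module_hom_app[OF L] by auto
  then show ?case using insert by (simp add: module_hom_add[OF L])
qed

text \<open>
  The form in which linear maps are evaluated on iterated sums: applied repeatedly, the rule peels
  off one sum at a time and leaves the value of the map on a single term.
\<close>

lemma module_hom_finsum_eqI:
  assumes U: "vectorspace K U" and P: "vectorspace K P" and L: "L \<in> module_hom K U P"
    and fin: "finite A" and f: "\<And>i. i \<in> A \<Longrightarrow> f i \<in> carrier U"
    and eq: "\<And>i. i \<in> A \<Longrightarrow> L (f i) = g i"
  shows "L (finsum U f A) = finsum P g A"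
proof -
  have g: "g i \<in> carrier P" if "i \<in> A" for i
    using eq[OF that] module_hom_app[OF L f[OF that]] by simp
  have "L (finsum U f A) = finsum P (\<lambda>i. L (f i)) A"
    using U P L fin f by (rule module_hom_finsum_apply)
  also have "\<dots> = finsum P g A" using P g eq by (rule finsum_cong_in)
  finally show ?thesis .
qed

lemma module_hom_cong:
  assumes U: "vectorspace K U" and f: "f \<in> module_hom K U P"
    and eq: "\<And>u. u \<in> carrier U \<Longrightarrow> g u = f u"
  shows "g \<in> module_hom K U P"
proof -
  interpret U: vectorspace K U by fact
  show ?thesis using f eq by (auto simp: module_hom_def Pi_iff)
qed

lemma module_hom_finsum:
  assumes P: "vectorspace K P" and fin: "finite A" and f: "\<And>i. i \<in> A \<Longrightarrow> f i \<in> module_hom K U P"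
    and U: "vectorspace K U"
  shows "(\<lambda>u. finsum P (\<lambda>i. f i u) A) \<in> module_hom K U P"
  using fin f
proof (induction A)
  interpret P: vectorspace K P by fact
  case empty
  then show ?case by (auto simp: module_hom_def)
next
  interpret P: vectorspace K P by fact
  case (insert a A)
  have "(\<lambda>u. f a u \<oplus>\<^bsub>P\<^esub> finsum P (\<lambda>i. f i u) A) \<in> module_hom K U P"
    using insert by (intro module_hom_plus[OF P]) auto
  moreover have "finsum P (\<lambda>i. f i u) (insert a A) = f a u \<oplus>\<^bsub>P\<^esub> finsum P (\<lambda>i. f i u) A"
    if "u \<in> carrier U" for u
    using insert.hyps module_hom_app[OF insert.prems that] by (intro P.M.finsum_insert) auto
  ultimately show ?case
    by (rule module_hom_cong[OF U])
qed

section \<open>Linearity of maps built from tensor products\<close>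

text \<open>
  Together with those for composition and sums, the rules of this section follow the syntax of an
  expression in one variable: resolution with them reduces the linearity of an iterated tensor
  expression to membership in carriers.
\<close>

lemma bilinear_mapI:
  assumes "\<And>w. w \<in> carrier W \<Longrightarrow> (\<lambda>v. f v w) \<in> module_hom K V P"
    and "\<And>v. v \<in> carrier V \<Longrightarrow> (\<lambda>w. f v w) \<in> module_hom K W P"
  shows "bilinear_map K V W P f"
  using assms by (auto simp: bilinear_map_def)

lemma module_hom_tens_left:
  assumes "vectorspace K V" "vectorspace K W" "f \<in> module_hom K U V" "w \<in> carrier W"
  shows "(\<lambda>u. tens K V W (f u) w) \<in> module_hom K U (tensor K V W)"
  using tens_bilinear[OF vectorspace_module[OF assms(1)] vectorspace_module[OF assms(2)]] assms(3,4)
  by (auto simp: bilinear_map_def intro: module_hom_comp)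

lemma module_hom_tens_right:
  assumes "vectorspace K V" "vectorspace K W" "f \<in> module_hom K U W" "v \<in> carrier V"
  shows "(\<lambda>u. tens K V W v (f u)) \<in> module_hom K U (tensor K V W)"
  using tens_bilinear[OF vectorspace_module[OF assms(1)] vectorspace_module[OF assms(2)]] assms(3,4)
  by (auto simp: bilinear_map_def intro: module_hom_comp)

lemma tensor_lift_hom:
  assumes "vectorspace K V" "vectorspace K W" "vectorspace K P" "bilinear_map K V W P f"
  shows "tensor_lift K V W P f \<in> module_hom K (tensor K V W) P"
  using tensor_lift_linear[OF assms] linear_map_iff_module_hom[OF tensor_vectorspace[OF assms(1,2)] assms(3)]
  by blast

lemma module_hom_tensor_lift:
  assumes "vectorspace K V" "vectorspace K W" "vectorspace K P" "bilinear_map K V W P f"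
    "g \<in> module_hom K U (tensor K V W)"
  shows "(\<lambda>u. tensor_lift K V W P f (g u)) \<in> module_hom K U P"
  by (rule module_hom_comp[OF tensor_lift_hom[OF assms(1-4)] assms(5)])

lemma tensor_eqI:
  assumes "vectorspace K V" "vectorspace K W" "vectorspace K P"
    "L \<in> module_hom K (tensor K V W) P" "L' \<in> module_hom K (tensor K V W) P"
    "\<And>v w. v \<in> carrier V \<Longrightarrow> w \<in> carrier W \<Longrightarrow> L (tens K V W v w) = L' (tens K V W v w)"
    "X \<in> carrier (tensor K V W)"
  shows "L X = L' X"
  by (rule tensor_hom_eqI[OF vectorspace_module[OF assms(1)] vectorspace_module[OF assms(2)]
     vectorspace_module[OF assms(3)] assms(4-7)])

text \<open>
  Linear dependence of an induced map on a parameter is checked on pure tensors, because the two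
  sides of each identity are linear in \<open>X\<close>. The maps defined by nested lifts (the associativity
  isomorphisms and the multiplication of \<open>A \<otimes> A\<close>) are bilinear for this reason.
\<close>

lemma module_hom_tensor_lift_param:
  assumes U: "vectorspace K U" and V: "vectorspace K V" and W: "vectorspace K W" and P: "vectorspace K P"
    and f: "\<And>u. u \<in> carrier U \<Longrightarrow> bilinear_map K V W P (f u)"
    and fu: "\<And>v w. v \<in> carrier V \<Longrightarrow> w \<in> carrier W \<Longrightarrow> (\<lambda>u. f u v w) \<in> module_hom K U P"
    and X: "X \<in> carrier (tensor K V W)"
  shows "(\<lambda>u. tensor_lift K V W P (f u) X) \<in> module_hom K U P"
proof -
  interpret U: vectorspace K U by fact
  note lin = tensor_lift_hom[OF V W P f]
  note val = tensor_lift_tens[OF V W P f]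
  have "tensor_lift K V W P (f (u \<oplus>\<^bsub>U\<^esub> u')) X
      = tensor_lift K V W P (f u) X \<oplus>\<^bsub>P\<^esub> tensor_lift K V W P (f u') X"
    if u: "u \<in> carrier U" "u' \<in> carrier U" for u u'
    by (rule tensor_eqI[OF V W P lin module_hom_plus[OF P lin lin] _ X])
       (use u in \<open>auto simp: val module_hom_add[OF fu]\<close>)
  moreover have "tensor_lift K V W P (f (c \<odot>\<^bsub>U\<^esub> u)) X = c \<odot>\<^bsub>P\<^esub> tensor_lift K V W P (f u) X"
    if u: "u \<in> carrier U" and c: "c \<in> carrier K" for u c
    by (rule tensor_eqI[OF V W P lin module_hom_scale[OF P lin c] _ X])
       (use u c in \<open>auto simp: val module_hom_smult[OF fu]\<close>)
  ultimately show ?thesis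
    unfolding module_hom_def using module_hom_app[OF lin X] by auto
qed

lemma tensor_map_bilinear:
  assumes "vectorspace K V" "vectorspace K W" "vectorspace K V'" "vectorspace K W'"
    "f \<in> module_hom K V V'" "g \<in> module_hom K W W'"
  shows "bilinear_map K V W (tensor K V' W') (\<lambda>v w. tens K V' W' (f v) (g w))"
  using module_hom_app[OF assms(5)] module_hom_app[OF assms(6)]
  by (intro bilinear_mapI module_hom_tens_left module_hom_tens_right assms)

lemma
  assumes "vectorspace K V" "vectorspace K W" "vectorspace K V'" "vectorspace K W'"
    "f \<in> module_hom K V V'" "g \<in> module_hom K W W'"
  shows tensor_map_hom: "tensor_map K V W V' W' f g \<in> module_hom K (tensor K V W) (tensor K V' W')"
    and tensor_map_tens: "v \<in> carrier V \<Longrightarrow> w \<in> carrier W \<Longrightarrow>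
      tensor_map K V W V' W' f g (tens K V W v w) = tens K V' W' (f v) (g w)"
  unfolding tensor_map_def
  using tensor_lift_hom[OF _ _ _ tensor_map_bilinear[OF assms]]
    tensor_lift_tens[OF _ _ _ tensor_map_bilinear[OF assms]] assms tensor_vectorspace by blast+

lemma
  assumes "vectorspace K V" "vectorspace K W"
  shows tensor_flip_hom: "tensor_flip K V W \<in> module_hom K (tensor K V W) (tensor K W V)"
    and tensor_flip_tens: "v \<in> carrier V \<Longrightarrow> w \<in> carrier W \<Longrightarrow>
      tensor_flip K V W (tens K V W v w) = tens K W V w v"
proof -
  have "bilinear_map K V W (tensor K W V) (\<lambda>v w. tens K W V w v)"
    using assms by (intro bilinear_mapI module_hom_tens_left module_hom_tens_right module_hom_id)
  from tensor_lift_hom[OF assms tensor_vectorspace[OF assms(2,1)] this]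
    tensor_lift_tens[OF assms tensor_vectorspace[OF assms(2,1)] this]
  show "tensor_flip K V W \<in> module_hom K (tensor K V W) (tensor K W V)"
    "v \<in> carrier V \<Longrightarrow> w \<in> carrier W \<Longrightarrow> tensor_flip K V W (tens K V W v w) = tens K W V w v"
    unfolding tensor_flip_def by auto
qed

lemma
  assumes U: "vectorspace K U" and V: "vectorspace K V" and W: "vectorspace K W"
  shows tensor_assoc_hom: "tensor_assoc K U V W \<in>
      module_hom K (tensor K (tensor K U V) W) (tensor K U (tensor K V W))"
    and tensor_assoc_tens: "u \<in> carrier U \<Longrightarrow> v \<in> carrier V \<Longrightarrow> w \<in> carrier W \<Longrightarrow>
      tensor_assoc K U V W (tens K (tensor K U V) W (tens K U V u v) w)
      = tens K U (tensor K V W) u (tens K V W v w)"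
proof -
  note vs = U V W tensor_vectorspace
  let ?T = "tensor K U (tensor K V W)"
  have b: "bilinear_map K U V ?T (\<lambda>u v. tens K U (tensor K V W) u (tens K V W v w))"
    if "w \<in> carrier W" for w
    using that by (intro bilinear_mapI module_hom_tens_left module_hom_tens_right module_hom_id vs tens_in)
  have B: "bilinear_map K (tensor K U V) W ?T
     (\<lambda>x w. tensor_lift K U V ?T (\<lambda>u v. tens K U (tensor K V W) u (tens K V W v w)) x)"
    by (intro bilinear_mapI module_hom_tensor_lift module_hom_tensor_lift_param b vs module_hom_id
         module_hom_tens_right tens_in)
  show "tensor_assoc K U V W \<in> module_hom K (tensor K (tensor K U V) W) (tensor K U (tensor K V W))"
    unfolding tensor_assoc_def by (intro tensor_lift_hom vs B)
  show "tensor_assoc K U V W (tens K (tensor K U V) W (tens K U V u v) w)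
      = tens K U (tensor K V W) u (tens K V W v w)"
    if "u \<in> carrier U" "v \<in> carrier V" "w \<in> carrier W"
    unfolding tensor_assoc_def using that b
    by (simp add: tensor_lift_tens[OF _ _ _ B] tensor_lift_tens vs tens_in)
qed

lemma
  assumes U: "vectorspace K U" and V: "vectorspace K V" and W: "vectorspace K W"
  shows tensor_assoc_inv_hom: "tensor_assoc_inv K U V W \<in>
      module_hom K (tensor K U (tensor K V W)) (tensor K (tensor K U V) W)"
    and tensor_assoc_inv_tens: "u \<in> carrier U \<Longrightarrow> v \<in> carrier V \<Longrightarrow> w \<in> carrier W \<Longrightarrow>
      tensor_assoc_inv K U V W (tens K U (tensor K V W) u (tens K V W v w))
      = tens K (tensor K U V) W (tens K U V u v) w"
proof -
  note vs = U V W tensor_vectorspace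
  let ?T = "tensor K (tensor K U V) W"
  have b: "bilinear_map K V W ?T (\<lambda>v w. tens K (tensor K U V) W (tens K U V u v) w)"
    if "u \<in> carrier U" for u
    using that by (intro bilinear_mapI module_hom_tens_left module_hom_tens_right module_hom_id vs tens_in)
  have B: "bilinear_map K U (tensor K V W) ?T
     (\<lambda>u y. tensor_lift K V W ?T (\<lambda>v w. tens K (tensor K U V) W (tens K U V u v) w) y)"
    by (intro bilinear_mapI module_hom_tensor_lift module_hom_tensor_lift_param b vs module_hom_id
         module_hom_tens_left tens_in)
  show "tensor_assoc_inv K U V W \<in> module_hom K (tensor K U (tensor K V W)) (tensor K (tensor K U V) W)"
    unfolding tensor_assoc_inv_def by (intro tensor_lift_hom vs B)
  show "tensor_assoc_inv K U V W (tens K U (tensor K V W) u (tens K V W v w))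
      = tens K (tensor K U V) W (tens K U V u v) w"
    if "u \<in> carrier U" "v \<in> carrier V" "w \<in> carrier W"
    unfolding tensor_assoc_inv_def using that b
    by (simp add: tensor_lift_tens[OF _ _ _ B] tensor_lift_tens vs tens_in)
qed

lemma
  assumes A: "vectorspace K A" and m: "m \<in> module_hom K (tensor K A A) A"
  shows tensor_mult_hom: "tensor_mult K A m \<in>
      module_hom K (tensor K (tensor K A A) (tensor K A A)) (tensor K A A)"
    and tensor_mult_tens: "a \<in> carrier A \<Longrightarrow> b \<in> carrier A \<Longrightarrow> a' \<in> carrier A \<Longrightarrow> b' \<in> carrier A \<Longrightarrow>
      tensor_mult K A m (tens K (tensor K A A) (tensor K A A) (tens K A A a b) (tens K A A a' b'))
      = tens K A A (m (tens K A A a a')) (m (tens K A A b b'))"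
proof -
  note vs = A tensor_vectorspace
  let ?T = "tensor K A A"
  note i = module_hom_tens_left module_hom_tens_right module_hom_id vs tens_in
    module_hom_comp[OF m] module_hom_app[OF m]
  let ?g = "\<lambda>a b a' b'. tens K A A (m (tens K A A a a')) (m (tens K A A b b'))"
  have b1: "bilinear_map K A A ?T (?g a b)" if "a \<in> carrier A" "b \<in> carrier A" for a b
    using that by (intro bilinear_mapI i)
  have b2: "bilinear_map K A A ?T (\<lambda>a b. tensor_lift K A A ?T (?g a b) y)" if "y \<in> carrier ?T" for y
    using that by (intro bilinear_mapI module_hom_tensor_lift_param b1 i)
  have B: "bilinear_map K ?T ?T ?T (\<lambda>x y. tensor_lift K A A ?T (\<lambda>a b. tensor_lift K A A ?T (?g a b) y) x)"
    by (intro bilinear_mapI module_hom_tensor_lift module_hom_tensor_lift_param b1 b2 i)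
  show "tensor_mult K A m \<in> module_hom K (tensor K ?T ?T) ?T"
    unfolding tensor_mult_def by (intro tensor_lift_hom vs B)
  show "tensor_mult K A m (tens K ?T ?T (tens K A A a b) (tens K A A a' b')) = ?g a b a' b'"
    if "a \<in> carrier A" "b \<in> carrier A" "a' \<in> carrier A" "b' \<in> carrier A"
    unfolding tensor_mult_def using that b1 b2
    by (simp add: tensor_lift_tens[OF _ _ _ B] tensor_lift_tens vs tens_in)
qed

section \<open>The Yang--Baxter equation for the universal element\<close>

context quasitriangular_hom_bialgebra
begin

abbreviation hmult (infixl "\<star>" 70) where "a \<star> b \<equiv> m (tens K H H a b)"
abbreviation HH where "HH \<equiv> tensor K H H"

lemma H_vs: "vectorspace K H" by unfold_locales
lemmas HH_vs = tensor_vectorspace[OF H_vs H_vs]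
lemmas H_vss = H_vs HH_vs tensor_vectorspace[OF HH_vs H_vs]

lemma m_hom: "m \<in> module_hom K HH H"
  and \<alpha>_hom: "\<alpha> \<in> module_hom K H H"
  and \<psi>_hom: "\<psi> \<in> module_hom K H H"
  and \<Delta>_hom: "\<Delta> \<in> module_hom K H HH"
  using mult_linear twist_linear cotwist_linear comult_linear
  by (simp_all add: linear_map_iff_module_hom H_vss)

lemma \<psi>_mult: "a \<in> carrier H \<Longrightarrow> b \<in> carrier H \<Longrightarrow> \<psi> (a \<star> b) = \<psi> a \<star> \<psi> b"
  using cotwist_morphism by (simp add: hom_alg_morphism_def)

lemma s_in: "i \<in> {..<n} \<Longrightarrow> s i \<in> carrier H" and t_in: "i \<in> {..<n} \<Longrightarrow> t i \<in> carrier H"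
  by (simp_all add: s_closed t_closed)

lemma R_in: "R \<in> carrier HH"
  unfolding R_eq by (intro finsum_in[OF HH_vs] tens_in s_in t_in H_vss)

lemmas H_app = module_hom_app[OF m_hom] module_hom_app[OF \<alpha>_hom] module_hom_app[OF \<psi>_hom]
  module_hom_app[OF \<Delta>_hom]
lemmas H_closed = H_app s_in t_in R_in tens_in H_vss
lemmas H_linear = module_hom_tens_left module_hom_tens_right module_hom_id
  module_hom_comp[OF m_hom] module_hom_comp[OF \<alpha>_hom] module_hom_comp[OF \<psi>_hom] module_hom_comp[OF \<Delta>_hom]

text \<open>
  A bilinear expression in \<open>s\<^sub>i\<close> and \<open>t\<^sub>i\<close>, summed over \<open>i\<close>, is the value at \<open>R\<close> of a linear map on
  \<open>H \<otimes> H\<close>. It therefore depends on \<open>R\<close> alone, not on its presentation, and \<open>(\<phi> s\<^sub>i, \<phi> t\<^sub>i)\<close>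
  presents \<open>R\<close> as well.
\<close>

lemma twist_sum:
  assumes \<phi>: "\<phi> \<in> module_hom K H H" and inv: "tensor_map K H H H H \<phi> \<phi> R = R"
    and P: "vectorspace K P" and f: "bilinear_map K H H P f"
  shows "(\<Oplus>\<^bsub>P\<^esub>i\<in>{..<n}. f (\<phi> (s i)) (\<phi> (t i))) = (\<Oplus>\<^bsub>P\<^esub>i\<in>{..<n}. f (s i) (t i))"
proof -
  note L = tensor_lift_hom[OF H_vs H_vs P f]
  note T = tensor_map_hom[OF H_vs H_vs H_vs H_vs \<phi> \<phi>]
  note \<phi>_app = module_hom_app[OF \<phi>]
  have "tensor_lift K H H P f R = (\<Oplus>\<^bsub>P\<^esub>i\<in>{..<n}. f (s i) (t i))"
    unfolding R_eq
    by (rule module_hom_finsum_eqI[OF HH_vs P L])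
       (simp_all add: tensor_lift_tens[OF H_vs H_vs P f] H_closed)
  moreover have "tensor_lift K H H P f (tensor_map K H H H H \<phi> \<phi> R)
      = (\<Oplus>\<^bsub>P\<^esub>i\<in>{..<n}. f (\<phi> (s i)) (\<phi> (t i)))"
    unfolding R_eq
    by (rule module_hom_finsum_eqI[OF HH_vs P module_hom_comp[OF L T]])
       (simp_all add: tensor_map_tens[OF H_vs H_vs H_vs H_vs \<phi> \<phi>] tensor_lift_tens[OF H_vs H_vs P f] H_closed \<phi>_app)
  ultimately show ?thesis by (simp add: inv)
qed

text \<open>
  The axiom for \<open>(\<Delta> \<otimes> \<alpha>) R\<close> has \<open>\<psi>\<close> on the \<open>s\<close> legs only. Applying \<open>\<psi>\<close> to the remaining leg puts it
  on every \<open>s\<close> and \<open>t\<close>, and the invariance of \<open>R\<close> under \<open>\<psi>\<close> then removes it everywhere; the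
  price is the \<open>\<psi>\<close> on the right-hand side.
\<close>

lemma comult_sum:
  assumes R_\<psi>: "tensor_map K H H H H \<psi> \<psi> R = R"
    and P: "vectorspace K P" and f: "bilinear_map K HH H P f"
  shows "(\<Oplus>\<^bsub>P\<^esub>i\<in>{..<n}. \<Oplus>\<^bsub>P\<^esub>j\<in>{..<n}. f (tens K H H (s i) (s j)) (t i \<star> t j))
       = (\<Oplus>\<^bsub>P\<^esub>i\<in>{..<n}. f (\<Delta> (s i)) (\<psi> (\<alpha> (t i))))"
proof -
  have f_left: "(\<lambda>u. f u c) \<in> module_hom K HH P" if "c \<in> carrier H" for c
    using f that by (simp add: bilinear_map_def)
  have f_right: "f v \<in> module_hom K H P" if "v \<in> carrier HH" for v
    using f that by (simp add: bilinear_map_def)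
  note f1 = module_hom_comp[OF f_left] and f2 = module_hom_comp[OF f_right]
  note f_in = module_hom_app[OF f_right]
  have b: "bilinear_map K HH H P (\<lambda>u c. f u (\<psi> c))"
  proof (rule bilinear_mapI)
    show "(\<lambda>u. f u (\<psi> c)) \<in> module_hom K HH P" if "c \<in> carrier H" for c
      by (rule f_left[OF H_app(3)[OF that]])
  qed (intro f2 H_linear)
  let ?L = "tensor_lift K HH H P (\<lambda>u c. f u (\<psi> c))"
  note L = tensor_lift_hom[OF HH_vs H_vs P b] and L_tens = tensor_lift_tens[OF HH_vs H_vs P b]
  have "?L (tensor_map K H H HH H \<Delta> \<alpha> R) = (\<Oplus>\<^bsub>P\<^esub>i\<in>{..<n}. f (\<Delta> (s i)) (\<psi> (\<alpha> (t i))))"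
    unfolding R_eq
    by (rule module_hom_finsum_eqI[OF HH_vs P module_hom_comp[OF L tensor_map_hom[OF H_vs H_vs HH_vs H_vs \<Delta>_hom \<alpha>_hom]]])
       (simp_all add: tensor_map_tens[OF H_vs H_vs HH_vs H_vs \<Delta>_hom \<alpha>_hom] L_tens H_closed)
  moreover have "?L (tensor_map K H H HH H \<Delta> \<alpha> R) = (\<Oplus>\<^bsub>P\<^esub>i\<in>{..<n}. \<Oplus>\<^bsub>P\<^esub>j\<in>{..<n}.
      f (tens K H H (\<psi> (s i)) (\<psi> (s j))) (\<psi> (t i) \<star> \<psi> (t j)))"
    unfolding comult_R_left
    by (intro module_hom_finsum_eqI[OF _ P L] finsum_in[OF tensor_vectorspace[OF HH_vs H_vs]] H_closed finite_lessThan)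
       (simp_all add: L_tens H_closed \<psi>_mult)
  moreover have "\<dots> = (\<Oplus>\<^bsub>P\<^esub>i\<in>{..<n}. \<Oplus>\<^bsub>P\<^esub>j\<in>{..<n}.
      f (tens K H H (s i) (\<psi> (s j))) (t i \<star> \<psi> (t j)))"
    by (rule twist_sum[OF \<psi>_hom R_\<psi> P])
       (intro bilinear_mapI module_hom_finsum f1 f2 H_linear H_closed P finite_lessThan)
  moreover have "\<dots> = (\<Oplus>\<^bsub>P\<^esub>i\<in>{..<n}. \<Oplus>\<^bsub>P\<^esub>j\<in>{..<n}. f (tens K H H (s i) (s j)) (t i \<star> t j))"
  proof (rule finsum_cong_in[OF P])
    fix i assume i: "i \<in> {..<n}"
    show "(\<Oplus>\<^bsub>P\<^esub>j\<in>{..<n}. f (tens K H H (s i) (\<psi> (s j))) (t i \<star> \<psi> (t j)))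
        = (\<Oplus>\<^bsub>P\<^esub>j\<in>{..<n}. f (tens K H H (s i) (s j)) (t i \<star> t j))"
      by (rule twist_sum[OF \<psi>_hom R_\<psi> P])
         (use i in \<open>intro bilinear_mapI f1 f2 H_linear H_closed\<close>)
  qed (intro finsum_in[OF P] f_in H_closed)
  ultimately show ?thesis by simp
qed

text \<open>
  For \<open>g a b c = a \<otimes> b \<otimes> c\<close> this is the quantum Yang--Baxter equation
  \<open>R\<^sub>2\<^sub>3 R\<^sub>1\<^sub>3 R\<^sub>1\<^sub>2 = R\<^sub>1\<^sub>2 R\<^sub>1\<^sub>3 R\<^sub>2\<^sub>3\<close>, which makes sense without associativity because only two
  factors meet in each leg. With \<open>i\<close> fixed on the left and \<open>k\<close> fixed on the right, both sides are
  instances of the left-hand side of \<open>comult_sum\<close>; on its right-hand side they become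
  \<open>\<Delta>\<^sup>c\<^sup>o\<^sup>p(h) R\<close> and \<open>R \<Delta>(h)\<close> in the first two legs, for \<open>h = s l\<close>.
\<close>

lemma quantum_yang_baxter:
  assumes R_\<psi>: "tensor_map K H H H H \<psi> \<psi> R = R"
    and P: "vectorspace K P"
    and g: "\<And>c. c \<in> carrier H \<Longrightarrow> bilinear_map K H H P (\<lambda>a b. g a b c)"
    and g3: "\<And>a b. a \<in> carrier H \<Longrightarrow> b \<in> carrier H \<Longrightarrow> g a b \<in> module_hom K H P"
  shows "(\<Oplus>\<^bsub>P\<^esub>i\<in>{..<n}. \<Oplus>\<^bsub>P\<^esub>j\<in>{..<n}. \<Oplus>\<^bsub>P\<^esub>k\<in>{..<n}. g (s j \<star> s i) (s k \<star> t i) (t k \<star> t j))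
       = (\<Oplus>\<^bsub>P\<^esub>i\<in>{..<n}. \<Oplus>\<^bsub>P\<^esub>j\<in>{..<n}. \<Oplus>\<^bsub>P\<^esub>k\<in>{..<n}. g (s k \<star> s j) (t k \<star> s i) (t j \<star> t i))"
proof -
  let ?N = "{..<n}"
  let ?G = "\<lambda>u c. tensor_lift K H H P (\<lambda>a b. g a b c) u"
  let ?mul = "\<lambda>u v. tensor_mult K H m (tens K HH HH u v)"
  have g_in: "g a b c \<in> carrier P" if "a \<in> carrier H" "b \<in> carrier H" "c \<in> carrier H" for a b c
    using module_hom_app[OF g3] that .
  note mul = module_hom_comp[OF tensor_mult_hom[OF H_vs m_hom]]
  note mul_in = module_hom_app[OF tensor_mult_hom[OF H_vs m_hom]]
  note flip = module_hom_comp[OF tensor_flip_hom[OF H_vs H_vs]]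
  note flip_in = module_hom_app[OF tensor_flip_hom[OF H_vs H_vs]]
  note i = H_linear H_closed P finite_lessThan mul mul_in flip flip_in g g3
  have G_tens: "?G (tens K H H a b) c = g a b c" if "a \<in> carrier H" "b \<in> carrier H" "c \<in> carrier H" for a b c
    by (rule tensor_lift_tens[OF H_vs H_vs P g]) fact+
  have bl: "bilinear_map K HH H P (\<lambda>u c. ?G (?mul (tensor_flip K H H u) R) c)"
    by (intro bilinear_mapI module_hom_tensor_lift module_hom_tensor_lift_param i)
  have br: "bilinear_map K HH H P (\<lambda>u c. ?G (?mul R u) c)"
    by (intro bilinear_mapI module_hom_tensor_lift module_hom_tensor_lift_param i)
  have left: "?G (?mul (tensor_flip K H H (tens K H H a b)) R) c = (\<Oplus>\<^bsub>P\<^esub>i\<in>?N. g (b \<star> s i) (a \<star> t i) c)"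
    if abc: "a \<in> carrier H" "b \<in> carrier H" "c \<in> carrier H" for a b c
    unfolding tensor_flip_tens[OF H_vs H_vs abc(1,2)] R_eq
    by (rule module_hom_finsum_eqI[OF HH_vs P])
       (use abc in \<open>(intro module_hom_tensor_lift i) |
          (simp add: tensor_mult_tens[OF H_vs m_hom] G_tens H_closed)\<close>)+
  have right: "?G (?mul R (tens K H H a b)) c = (\<Oplus>\<^bsub>P\<^esub>i\<in>?N. g (s i \<star> a) (t i \<star> b) c)"
    if abc: "a \<in> carrier H" "b \<in> carrier H" "c \<in> carrier H" for a b c
    unfolding R_eq
    by (rule module_hom_finsum_eqI[OF HH_vs P])
       (use abc in \<open>(intro module_hom_tensor_lift i) |
          (simp add: tensor_mult_tens[OF H_vs m_hom] G_tens H_closed)\<close>)+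
  have "(\<Oplus>\<^bsub>P\<^esub>i\<in>?N. \<Oplus>\<^bsub>P\<^esub>j\<in>?N. \<Oplus>\<^bsub>P\<^esub>k\<in>?N. g (s j \<star> s i) (s k \<star> t i) (t k \<star> t j))
      = (\<Oplus>\<^bsub>P\<^esub>i\<in>?N. \<Oplus>\<^bsub>P\<^esub>k\<in>?N. \<Oplus>\<^bsub>P\<^esub>j\<in>?N. g (s j \<star> s i) (s k \<star> t i) (t k \<star> t j))"
    by (rule finsum_cong_in[OF P _ finsum_swap[OF P]]; intro finsum_in[OF P] g_in i)
  also have "\<dots> = (\<Oplus>\<^bsub>P\<^esub>k\<in>?N. \<Oplus>\<^bsub>P\<^esub>i\<in>?N. \<Oplus>\<^bsub>P\<^esub>j\<in>?N. g (s j \<star> s i) (s k \<star> t i) (t k \<star> t j))"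
    by (intro finsum_swap[OF P] finsum_in[OF P] g_in i)
  also have "\<dots> = (\<Oplus>\<^bsub>P\<^esub>k\<in>?N. \<Oplus>\<^bsub>P\<^esub>j\<in>?N. \<Oplus>\<^bsub>P\<^esub>i\<in>?N. g (s j \<star> s i) (s k \<star> t i) (t k \<star> t j))"
    by (rule finsum_cong_in[OF P _ finsum_swap[OF P]]; intro finsum_in[OF P] g_in i)
  \<comment> \<open>With \<open>i\<close> innermost, the sum over \<open>i\<close> assembles a factor \<open>R\<close>.\<close>
  also have "\<dots> = (\<Oplus>\<^bsub>P\<^esub>k\<in>?N. \<Oplus>\<^bsub>P\<^esub>j\<in>?N. ?G (?mul (tensor_flip K H H (tens K H H (s k) (s j))) R) (t k \<star> t j))"
    by (intro finsum_cong_in[OF P] finsum_in[OF P] module_hom_app[OF tensor_lift_hom[OF H_vs H_vs P g]] left[symmetric] i)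
  also have "\<dots> = (\<Oplus>\<^bsub>P\<^esub>l\<in>?N. ?G (?mul (tensor_flip K H H (\<Delta> (s l))) R) (\<psi> (\<alpha> (t l))))"
    by (rule comult_sum[OF R_\<psi> P bl])
  also have "\<dots> = (\<Oplus>\<^bsub>P\<^esub>l\<in>?N. ?G (?mul R (\<Delta> (s l))) (\<psi> (\<alpha> (t l))))"
    by (intro finsum_cong_in[OF P] module_hom_app[OF tensor_lift_hom[OF H_vs H_vs P g]] i)
       (simp_all add: R_comult s_closed)
  also have "\<dots> = (\<Oplus>\<^bsub>P\<^esub>j\<in>?N. \<Oplus>\<^bsub>P\<^esub>i\<in>?N. ?G (?mul R (tens K H H (s j) (s i))) (t j \<star> t i))"
    by (rule comult_sum[OF R_\<psi> P br, symmetric])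
  also have "\<dots> = (\<Oplus>\<^bsub>P\<^esub>j\<in>?N. \<Oplus>\<^bsub>P\<^esub>i\<in>?N. \<Oplus>\<^bsub>P\<^esub>k\<in>?N. g (s k \<star> s j) (t k \<star> s i) (t j \<star> t i))"
    by (intro finsum_cong_in[OF P] finsum_in[OF P] g_in right i)
  also have "\<dots> = (\<Oplus>\<^bsub>P\<^esub>i\<in>?N. \<Oplus>\<^bsub>P\<^esub>j\<in>?N. \<Oplus>\<^bsub>P\<^esub>k\<in>?N. g (s k \<star> s j) (t k \<star> s i) (t j \<star> t i))"
    by (intro finsum_swap[OF P] finsum_in[OF P] g_in i)
  finally show ?thesis .
qed

end


section \<open>The braiding on a module\<close>

locale twist_invariant_hom_module =
  quasitriangular_hom_bialgebra K H m \<Delta> \<alpha> \<psi> R n s t + left_hom_module K H m \<alpha> M \<alpha>\<^sub>M act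
    for K :: "('k, 'r) ring_scheme" and H :: "('k, 'h, 'y) module_scheme" and m \<Delta> \<alpha> \<psi> R n s t
    and M :: "('k, 'm, 'z) module_scheme" and \<alpha>\<^sub>M act +
  assumes R_\<alpha>: "tensor_map K H H H H \<alpha> \<alpha> R = R"
    and R_\<psi>: "tensor_map K H H H H \<psi> \<psi> R = R"
begin

abbreviation action (infixr "\<bullet>" 75) where "h \<bullet> x \<equiv> act (tens K H M h x)"
abbreviation MM where "MM \<equiv> tensor K M M"
abbreviation MMM where "MMM \<equiv> tensor K MM M"
abbreviation tens2 (infixl "\<otimes>\<otimes>" 65) where "x \<otimes>\<otimes> y \<equiv> tens K M M x y"
abbreviation tens3 (infixl "\<otimes>\<otimes>\<otimes>" 65) where "X \<otimes>\<otimes>\<otimes> z \<equiv> tens K MM M X z"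

definition braid where
  "braid = tensor_lift K M M MM (\<lambda>x x'. \<Oplus>\<^bsub>MM\<^esub>i\<in>{..<n}. t i \<bullet> x' \<otimes>\<otimes> s i \<bullet> x)"

lemma M_vs: "vectorspace K M" by unfold_locales
lemmas MM_vs = tensor_vectorspace[OF M_vs M_vs]
lemmas MMM_vs = tensor_vectorspace[OF MM_vs M_vs]
lemmas M_MM_vs = tensor_vectorspace[OF M_vs MM_vs]

lemma act_hom: "act \<in> module_hom K (tensor K H M) M"
  and \<alpha>\<^sub>M_hom: "\<alpha>\<^sub>M \<in> module_hom K M M"
  using act_linear module_twist_linear
  by (simp_all add: linear_map_iff_module_hom H_vs M_vs tensor_vectorspace)

lemmas M_app = module_hom_app[OF act_hom] module_hom_app[OF \<alpha>\<^sub>M_hom]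
lemmas M_closed = M_app M_vs MM_vs MMM_vs M_MM_vs finsum_in[OF MM_vs] finsum_in[OF MMM_vs] H_closed
lemmas M_linear = module_hom_finsum[OF MM_vs] module_hom_finsum[OF MMM_vs]
  module_hom_comp[OF act_hom] module_hom_comp[OF \<alpha>\<^sub>M_hom] H_linear finite_lessThan

lemma braid_bilinear: "bilinear_map K M M MM (\<lambda>x x'. \<Oplus>\<^bsub>MM\<^esub>i\<in>{..<n}. t i \<bullet> x' \<otimes>\<otimes> s i \<bullet> x)"
  by (intro bilinear_mapI M_linear M_closed)

lemma braid_hom: "braid \<in> module_hom K MM MM"
  unfolding braid_def by (rule tensor_lift_hom[OF M_vs M_vs MM_vs braid_bilinear])

lemma braid_tens:
  "x \<in> carrier M \<Longrightarrow> y \<in> carrier M \<Longrightarrow> braid (x \<otimes>\<otimes> y) = (\<Oplus>\<^bsub>MM\<^esub>i\<in>{..<n}. t i \<bullet> y \<otimes>\<otimes> s i \<bullet> x)"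
  unfolding braid_def by (rule tensor_lift_tens[OF M_vs M_vs MM_vs braid_bilinear])

text \<open>
  This form puts a twist on the acting elements, so that the module axiom applies when the braiding
  meets vectors that are themselves of the form \<open>h \<bullet> x\<close>.
\<close>

lemma braid_tens_twisted:
  assumes "x \<in> carrier M" "y \<in> carrier M"
  shows "braid (x \<otimes>\<otimes> y) = (\<Oplus>\<^bsub>MM\<^esub>i\<in>{..<n}. \<alpha> (t i) \<bullet> y \<otimes>\<otimes> \<alpha> (s i) \<bullet> x)"
  unfolding braid_tens[OF assms]
  by (rule twist_sum[OF \<alpha>_hom R_\<alpha> MM_vs, symmetric])
     (use assms in \<open>intro bilinear_mapI M_linear M_closed\<close>)

lemma \<alpha>\<alpha>_hom: "tensor_map K M M M M \<alpha>\<^sub>M \<alpha>\<^sub>M \<in> module_hom K MM MM"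
  by (rule tensor_map_hom[OF M_vs M_vs M_vs M_vs \<alpha>\<^sub>M_hom \<alpha>\<^sub>M_hom])

lemma braid_twist:
  assumes X: "X \<in> carrier MM"
  shows "tensor_map K M M M M \<alpha>\<^sub>M \<alpha>\<^sub>M (braid X) = braid (tensor_map K M M M M \<alpha>\<^sub>M \<alpha>\<^sub>M X)"
proof (rule tensor_eqI[OF M_vs M_vs MM_vs _ _ _ X])
  note \<alpha>\<alpha>_tens = tensor_map_tens[OF M_vs M_vs M_vs M_vs \<alpha>\<^sub>M_hom \<alpha>\<^sub>M_hom]
  fix x y assume xy: "x \<in> carrier M" "y \<in> carrier M"
  have "tensor_map K M M M M \<alpha>\<^sub>M \<alpha>\<^sub>M (braid (x \<otimes>\<otimes> y))
      = (\<Oplus>\<^bsub>MM\<^esub>i\<in>{..<n}. \<alpha> (t i) \<bullet> \<alpha>\<^sub>M y \<otimes>\<otimes> \<alpha> (s i) \<bullet> \<alpha>\<^sub>M x)"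
    unfolding braid_tens[OF xy]
    by (rule module_hom_finsum_eqI[OF MM_vs MM_vs \<alpha>\<alpha>_hom])
       (use xy in \<open>simp_all add: \<alpha>\<alpha>_tens M_closed twist_act\<close>)
  also have "\<dots> = braid (tensor_map K M M M M \<alpha>\<^sub>M \<alpha>\<^sub>M (x \<otimes>\<otimes> y))"
    using xy by (simp add: \<alpha>\<alpha>_tens braid_tens_twisted M_closed)
  finally show "tensor_map K M M M M \<alpha>\<^sub>M \<alpha>\<^sub>M (braid (x \<otimes>\<otimes> y)) = braid (tensor_map K M M M M \<alpha>\<^sub>M \<alpha>\<^sub>M (x \<otimes>\<otimes> y))" .
qed (intro module_hom_comp[OF \<alpha>\<alpha>_hom] module_hom_comp[OF braid_hom] \<alpha>\<alpha>_hom braid_hom)+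

text \<open>
  The maps \<open>B \<otimes> \<alpha>\<^sub>M\<close> and \<open>\<alpha>\<^sub>M \<otimes> B\<close> on \<open>(M \<otimes> M) \<otimes> M\<close>, where \<open>B\<close> is the braiding.
\<close>

definition braid_left where "braid_left = tensor_map K MM M MM M braid \<alpha>\<^sub>M"
definition braid_right where "braid_right = (\<lambda>X. tensor_assoc_inv K M M M
   (tensor_map K M MM M MM \<alpha>\<^sub>M braid (tensor_assoc K M M M X)))"

lemma braid_left_hom: "braid_left \<in> module_hom K MMM MMM"
  unfolding braid_left_def by (rule tensor_map_hom[OF MM_vs M_vs MM_vs M_vs braid_hom \<alpha>\<^sub>M_hom])

lemma braid_right_hom: "braid_right \<in> module_hom K MMM MMM"
  unfolding braid_right_def
  by (intro module_hom_comp[OF tensor_assoc_inv_hom[OF M_vs M_vs M_vs]]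
      module_hom_comp[OF tensor_map_hom[OF M_vs MM_vs M_vs MM_vs \<alpha>\<^sub>M_hom braid_hom]]
      tensor_assoc_hom[OF M_vs M_vs M_vs])

text \<open>
  The families \<open>a\<close> and \<open>b\<close> stand for a presentation of \<open>R\<close>, such as \<open>(s, t)\<close> and its twist by \<open>\<alpha>\<close>;
  the same holds in the corresponding lemma for \<open>\<alpha>\<^sub>M \<otimes> B\<close>.
\<close>

lemma braid_left_tens:
  assumes xyz: "x \<in> carrier M" "y \<in> carrier M" "z \<in> carrier M"
    and ab: "\<And>i. i \<in> {..<n} \<Longrightarrow> a i \<in> carrier H" "\<And>i. i \<in> {..<n} \<Longrightarrow> b i \<in> carrier H"
    and braid: "braid (x \<otimes>\<otimes> y) = (\<Oplus>\<^bsub>MM\<^esub>i\<in>{..<n}. b i \<bullet> y \<otimes>\<otimes> a i \<bullet> x)"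
  shows "braid_left (x \<otimes>\<otimes> y \<otimes>\<otimes>\<otimes> z) = (\<Oplus>\<^bsub>MMM\<^esub>i\<in>{..<n}. b i \<bullet> y \<otimes>\<otimes> a i \<bullet> x \<otimes>\<otimes>\<otimes> \<alpha>\<^sub>M z)"
proof -
  have "braid_left (x \<otimes>\<otimes> y \<otimes>\<otimes>\<otimes> z) = braid (x \<otimes>\<otimes> y) \<otimes>\<otimes>\<otimes> \<alpha>\<^sub>M z"
    unfolding braid_left_def using xyz
    by (simp add: tensor_map_tens[OF MM_vs M_vs MM_vs M_vs braid_hom \<alpha>\<^sub>M_hom] M_closed)
  also have "\<dots> = (\<Oplus>\<^bsub>MMM\<^esub>i\<in>{..<n}. b i \<bullet> y \<otimes>\<otimes> a i \<bullet> x \<otimes>\<otimes>\<otimes> \<alpha>\<^sub>M z)"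
    unfolding braid
    by (rule module_hom_finsum_eqI[OF MM_vs MMM_vs module_hom_tens_left[OF MM_vs M_vs module_hom_id]])
       (use xyz ab in \<open>simp_all add: M_closed\<close>)
  finally show ?thesis .
qed

lemma braid_right_tens:
  assumes xyz: "x \<in> carrier M" "y \<in> carrier M" "z \<in> carrier M"
    and ab: "\<And>i. i \<in> {..<n} \<Longrightarrow> a i \<in> carrier H" "\<And>i. i \<in> {..<n} \<Longrightarrow> b i \<in> carrier H"
    and braid: "braid (y \<otimes>\<otimes> z) = (\<Oplus>\<^bsub>MM\<^esub>i\<in>{..<n}. b i \<bullet> z \<otimes>\<otimes> a i \<bullet> y)"
  shows "braid_right (x \<otimes>\<otimes> y \<otimes>\<otimes>\<otimes> z) = (\<Oplus>\<^bsub>MMM\<^esub>i\<in>{..<n}. \<alpha>\<^sub>M x \<otimes>\<otimes> b i \<bullet> z \<otimes>\<otimes>\<otimes> a i \<bullet> y)"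
proof -
  have "braid_right (x \<otimes>\<otimes> y \<otimes>\<otimes>\<otimes> z) = tensor_assoc_inv K M M M (tens K M MM (\<alpha>\<^sub>M x) (braid (y \<otimes>\<otimes> z)))"
    unfolding braid_right_def using xyz
    by (simp add: tensor_assoc_tens tensor_map_tens[OF M_vs MM_vs M_vs MM_vs \<alpha>\<^sub>M_hom braid_hom] M_closed)
  also have "\<dots> = (\<Oplus>\<^bsub>MMM\<^esub>i\<in>{..<n}. \<alpha>\<^sub>M x \<otimes>\<otimes> b i \<bullet> z \<otimes>\<otimes>\<otimes> a i \<bullet> y)"
    unfolding braid
    by (rule module_hom_finsum_eqI[OF MM_vs MMM_vs module_hom_comp[OF tensor_assoc_inv_hom[OF M_vs M_vs M_vs]
          module_hom_tens_right[OF M_vs MM_vs module_hom_id]]])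
       (use xyz ab in \<open>simp_all add: M_closed tensor_assoc_inv_tens\<close>)
  finally show ?thesis .
qed

lemma
  assumes "x \<in> carrier M" "y \<in> carrier M" "z \<in> carrier M"
  shows braid_left_plain:
      "braid_left (x \<otimes>\<otimes> y \<otimes>\<otimes>\<otimes> z) = (\<Oplus>\<^bsub>MMM\<^esub>i\<in>{..<n}. t i \<bullet> y \<otimes>\<otimes> s i \<bullet> x \<otimes>\<otimes>\<otimes> \<alpha>\<^sub>M z)"
    and braid_left_twisted:
      "braid_left (x \<otimes>\<otimes> y \<otimes>\<otimes>\<otimes> z) = (\<Oplus>\<^bsub>MMM\<^esub>i\<in>{..<n}. \<alpha> (t i) \<bullet> y \<otimes>\<otimes> \<alpha> (s i) \<bullet> x \<otimes>\<otimes>\<otimes> \<alpha>\<^sub>M z)"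
    and braid_right_plain:
      "braid_right (x \<otimes>\<otimes> y \<otimes>\<otimes>\<otimes> z) = (\<Oplus>\<^bsub>MMM\<^esub>i\<in>{..<n}. \<alpha>\<^sub>M x \<otimes>\<otimes> t i \<bullet> z \<otimes>\<otimes>\<otimes> s i \<bullet> y)"
    and braid_right_twisted:
      "braid_right (x \<otimes>\<otimes> y \<otimes>\<otimes>\<otimes> z) = (\<Oplus>\<^bsub>MMM\<^esub>i\<in>{..<n}. \<alpha>\<^sub>M x \<otimes>\<otimes> \<alpha> (t i) \<bullet> z \<otimes>\<otimes>\<otimes> \<alpha> (s i) \<bullet> y)"
proof -
  show "braid_left (x \<otimes>\<otimes> y \<otimes>\<otimes>\<otimes> z) = (\<Oplus>\<^bsub>MMM\<^esub>i\<in>{..<n}. t i \<bullet> y \<otimes>\<otimes> s i \<bullet> x \<otimes>\<otimes>\<otimes> \<alpha>\<^sub>M z)"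
    by (intro braid_left_tens braid_tens assms H_closed)
  show "braid_left (x \<otimes>\<otimes> y \<otimes>\<otimes>\<otimes> z) = (\<Oplus>\<^bsub>MMM\<^esub>i\<in>{..<n}. \<alpha> (t i) \<bullet> y \<otimes>\<otimes> \<alpha> (s i) \<bullet> x \<otimes>\<otimes>\<otimes> \<alpha>\<^sub>M z)"
    by (intro braid_left_tens braid_tens_twisted assms H_closed)
  show "braid_right (x \<otimes>\<otimes> y \<otimes>\<otimes>\<otimes> z) = (\<Oplus>\<^bsub>MMM\<^esub>i\<in>{..<n}. \<alpha>\<^sub>M x \<otimes>\<otimes> t i \<bullet> z \<otimes>\<otimes>\<otimes> s i \<bullet> y)"
    by (intro braid_right_tens braid_tens assms H_closed)
  show "braid_right (x \<otimes>\<otimes> y \<otimes>\<otimes>\<otimes> z) = (\<Oplus>\<^bsub>MMM\<^esub>i\<in>{..<n}. \<alpha>\<^sub>M x \<otimes>\<otimes> \<alpha> (t i) \<bullet> z \<otimes>\<otimes>\<otimes> \<alpha> (s i) \<bullet> y)"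
    by (intro braid_right_tens braid_tens_twisted assms H_closed)
qed

text \<open>
  On each side, the last of the three maps is evaluated in its twisted form: its twist, and the
  compatibility of \<open>\<alpha>\<^sub>M\<close> with the action, absorb the iterated actions. What is left over is one more \<open>\<alpha>\<close> on the terms
  contributed by the first map, removed by \<open>twist_sum\<close>.
\<close>

lemma braid_yang_baxter_tens:
  assumes xyz: "x \<in> carrier M" "y \<in> carrier M" "z \<in> carrier M"
  shows "braid_left (braid_right (braid_left (x \<otimes>\<otimes> y \<otimes>\<otimes>\<otimes> z)))
       = braid_right (braid_left (braid_right (x \<otimes>\<otimes> y \<otimes>\<otimes>\<otimes> z)))"
proof -
  let ?N = "{..<n}"
  let ?v = "\<lambda>a b c. c \<bullet> \<alpha>\<^sub>M (\<alpha>\<^sub>M z) \<otimes>\<otimes> b \<bullet> \<alpha>\<^sub>M (\<alpha>\<^sub>M y) \<otimes>\<otimes>\<otimes> a \<bullet> \<alpha>\<^sub>M (\<alpha>\<^sub>M x)"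
  note eqI = module_hom_finsum_eqI[OF MMM_vs MMM_vs]
  have right3: "braid_right (braid_left (braid_right (x \<otimes>\<otimes> y \<otimes>\<otimes>\<otimes> z))) = (\<Oplus>\<^bsub>MMM\<^esub>i\<in>?N. \<Oplus>\<^bsub>MMM\<^esub>j\<in>?N. \<Oplus>\<^bsub>MMM\<^esub>k\<in>?N.
      \<alpha>\<^sub>M (t j \<bullet> t i \<bullet> z) \<otimes>\<otimes> \<alpha> (t k) \<bullet> \<alpha>\<^sub>M (s i \<bullet> y) \<otimes>\<otimes>\<otimes> \<alpha> (s k) \<bullet> s j \<bullet> \<alpha>\<^sub>M x)"
    (is "_ = (\<Oplus>\<^bsub>MMM\<^esub>i\<in>?N. \<Oplus>\<^bsub>MMM\<^esub>j\<in>?N. ?r i j)")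
  proof -
    have k: "braid_right (t j \<bullet> t i \<bullet> z \<otimes>\<otimes> s j \<bullet> \<alpha>\<^sub>M x \<otimes>\<otimes>\<otimes> \<alpha>\<^sub>M (s i \<bullet> y)) = ?r i j"
      if "i \<in> ?N" "j \<in> ?N" for i j
      by (intro braid_right_twisted M_closed xyz that)
    have j: "braid_right (braid_left (\<alpha>\<^sub>M x \<otimes>\<otimes> t i \<bullet> z \<otimes>\<otimes>\<otimes> s i \<bullet> y)) = (\<Oplus>\<^bsub>MMM\<^esub>j\<in>?N. ?r i j)"
      if i: "i \<in> ?N" for i
    proof -
      have "braid_left (\<alpha>\<^sub>M x \<otimes>\<otimes> t i \<bullet> z \<otimes>\<otimes>\<otimes> s i \<bullet> y)
          = (\<Oplus>\<^bsub>MMM\<^esub>j\<in>?N. t j \<bullet> t i \<bullet> z \<otimes>\<otimes> s j \<bullet> \<alpha>\<^sub>M x \<otimes>\<otimes>\<otimes> \<alpha>\<^sub>M (s i \<bullet> y))"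
        by (intro braid_left_plain M_closed xyz i)
      then show ?thesis
        by (simp only:) (intro eqI[OF braid_right_hom finite_lessThan] k M_closed xyz i)
    qed
    show ?thesis
      unfolding braid_right_plain[OF xyz]
      by (intro eqI[OF module_hom_comp[OF braid_right_hom braid_left_hom] finite_lessThan] j M_closed xyz)
  qed
  have "braid_left (braid_right (braid_left (x \<otimes>\<otimes> y \<otimes>\<otimes>\<otimes> z))) = (\<Oplus>\<^bsub>MMM\<^esub>i\<in>?N. \<Oplus>\<^bsub>MMM\<^esub>j\<in>?N. \<Oplus>\<^bsub>MMM\<^esub>k\<in>?N.
      \<alpha> (t k) \<bullet> t j \<bullet> \<alpha>\<^sub>M z \<otimes>\<otimes> \<alpha> (s k) \<bullet> \<alpha>\<^sub>M (t i \<bullet> y) \<otimes>\<otimes>\<otimes> \<alpha>\<^sub>M (s j \<bullet> s i \<bullet> x))"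
    (is "_ = (\<Oplus>\<^bsub>MMM\<^esub>i\<in>?N. \<Oplus>\<^bsub>MMM\<^esub>j\<in>?N. ?l i j)")
  proof -
    have k: "braid_left (\<alpha>\<^sub>M (t i \<bullet> y) \<otimes>\<otimes> t j \<bullet> \<alpha>\<^sub>M z \<otimes>\<otimes>\<otimes> s j \<bullet> s i \<bullet> x) = ?l i j"
      if "i \<in> ?N" "j \<in> ?N" for i j
      by (intro braid_left_twisted M_closed xyz that)
    have j: "braid_left (braid_right (t i \<bullet> y \<otimes>\<otimes> s i \<bullet> x \<otimes>\<otimes>\<otimes> \<alpha>\<^sub>M z)) = (\<Oplus>\<^bsub>MMM\<^esub>j\<in>?N. ?l i j)"
      if i: "i \<in> ?N" for i
    proof -
      have "braid_right (t i \<bullet> y \<otimes>\<otimes> s i \<bullet> x \<otimes>\<otimes>\<otimes> \<alpha>\<^sub>M z)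
          = (\<Oplus>\<^bsub>MMM\<^esub>j\<in>?N. \<alpha>\<^sub>M (t i \<bullet> y) \<otimes>\<otimes> t j \<bullet> \<alpha>\<^sub>M z \<otimes>\<otimes>\<otimes> s j \<bullet> s i \<bullet> x)"
        by (intro braid_right_plain M_closed xyz i)
      then show ?thesis
        by (simp only:) (intro eqI[OF braid_left_hom finite_lessThan] k M_closed xyz i)
    qed
    show ?thesis
      unfolding braid_left_plain[OF xyz]
      by (intro eqI[OF module_hom_comp[OF braid_left_hom braid_right_hom] finite_lessThan] j M_closed xyz)
  qed
  also have "\<dots> = (\<Oplus>\<^bsub>MMM\<^esub>i\<in>?N. \<Oplus>\<^bsub>MMM\<^esub>j\<in>?N. \<Oplus>\<^bsub>MMM\<^esub>k\<in>?N. ?v (s j \<star> \<alpha> (s i)) (s k \<star> \<alpha> (t i)) (t k \<star> t j))"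
    by (intro finsum_cong_in[OF MMM_vs] M_closed xyz)
       (simp_all add: twist_act act_act M_closed xyz)
  also have "\<dots> = (\<Oplus>\<^bsub>MMM\<^esub>i\<in>?N. \<Oplus>\<^bsub>MMM\<^esub>j\<in>?N. \<Oplus>\<^bsub>MMM\<^esub>k\<in>?N. ?v (s j \<star> s i) (s k \<star> t i) (t k \<star> t j))"
    by (rule twist_sum[OF \<alpha>_hom R_\<alpha> MMM_vs]) (intro bilinear_mapI M_linear M_closed xyz)
  also have "\<dots> = (\<Oplus>\<^bsub>MMM\<^esub>i\<in>?N. \<Oplus>\<^bsub>MMM\<^esub>j\<in>?N. \<Oplus>\<^bsub>MMM\<^esub>k\<in>?N. ?v (s k \<star> s j) (t k \<star> s i) (t j \<star> t i))"
    by (rule quantum_yang_baxter[OF R_\<psi> MMM_vs]; intro bilinear_mapI M_linear M_closed xyz)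
  also have "\<dots> = (\<Oplus>\<^bsub>MMM\<^esub>i\<in>?N. \<Oplus>\<^bsub>MMM\<^esub>j\<in>?N. \<Oplus>\<^bsub>MMM\<^esub>k\<in>?N. ?v (s k \<star> s j) (t k \<star> \<alpha> (s i)) (t j \<star> \<alpha> (t i)))"
    by (rule twist_sum[OF \<alpha>_hom R_\<alpha> MMM_vs, symmetric]) (intro bilinear_mapI M_linear M_closed xyz)
  also have "\<dots> = (\<Oplus>\<^bsub>MMM\<^esub>i\<in>?N. \<Oplus>\<^bsub>MMM\<^esub>j\<in>?N. \<Oplus>\<^bsub>MMM\<^esub>k\<in>?N.
      \<alpha>\<^sub>M (t j \<bullet> t i \<bullet> z) \<otimes>\<otimes> \<alpha> (t k) \<bullet> \<alpha>\<^sub>M (s i \<bullet> y) \<otimes>\<otimes>\<otimes> \<alpha> (s k) \<bullet> s j \<bullet> \<alpha>\<^sub>M x)"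
    by (intro finsum_cong_in[OF MMM_vs] M_closed xyz)
       (simp_all add: twist_act act_act M_closed xyz)
  also note right3[symmetric]
  finally show ?thesis .
qed

lemma braid_yang_baxter:
  assumes X: "X \<in> carrier MMM"
  shows "braid_left (braid_right (braid_left X)) = braid_right (braid_left (braid_right X))"
proof -
  note bl = module_hom_comp[OF braid_left_hom] and br = module_hom_comp[OF braid_right_hom]
  have L: "(\<lambda>X. braid_left (braid_right (braid_left X))) \<in> module_hom K MMM MMM"
    and L': "(\<lambda>X. braid_right (braid_left (braid_right X))) \<in> module_hom K MMM MMM"
    by (rule bl br braid_left_hom braid_right_hom)+
  note tl = module_hom_tens_left[OF MM_vs M_vs module_hom_id]
  show ?thesis
  proof (rule tensor_eqI[OF MM_vs M_vs MMM_vs L L' _ X])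
    fix U z assume U: "U \<in> carrier MM" and z: "z \<in> carrier M"
    show "braid_left (braid_right (braid_left (U \<otimes>\<otimes>\<otimes> z))) = braid_right (braid_left (braid_right (U \<otimes>\<otimes>\<otimes> z)))"
      by (rule tensor_eqI[OF M_vs M_vs MMM_vs module_hom_comp[OF L tl[OF z]] module_hom_comp[OF L' tl[OF z]]
            braid_yang_baxter_tens[OF _ _ z] U])
  qed
qed

theorem hom_yang_baxter_braid: "hom_yang_baxter K M \<alpha>\<^sub>M braid"
  unfolding hom_yang_baxter_def Let_def
  using M_vs \<alpha>\<^sub>M_hom braid_hom braid_twist braid_yang_baxter[unfolded braid_left_def braid_right_def]
  by (simp add: linear_map_iff_module_hom MM_vs)

end

theorem proposition6p13:
  fixes K :: "('k, 'r) ring_scheme"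
    and H :: "('k, 'h, 'y) module_scheme"
    and M :: "('k, 'm, 'z) module_scheme"
  assumes H: "quasitriangular_hom_bialgebra K H m \<Delta> \<alpha> \<psi> R n s t"
    and R_\<alpha>: "tensor_map K H H H H \<alpha> \<alpha> R = R"
    and R_\<psi>: "tensor_map K H H H H \<psi> \<psi> R = R"
    and M: "left_hom_module K H m \<alpha> M \<alpha>\<^sub>M act"
  shows "let B = tensor_lift K M M (tensor K M M)
                   (\<lambda>x x'. \<Oplus>\<^bsub>tensor K M M\<^esub>i\<in>{..<n}.
                      tens K M M (act (tens K H M (t i) x')) (act (tens K H M (s i) x)))
         in (\<forall>x\<in>carrier M. \<forall>x'\<in>carrier M.
               B (tens K M M x x') =
                 (\<Oplus>\<^bsub>tensor K M M\<^esub>i\<in>{..<n}.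
                    tens K M M (act (tens K H M (t i) x')) (act (tens K H M (s i) x)))) \<and>
            hom_yang_baxter K M \<alpha>\<^sub>M B"
proof -
  interpret twist_invariant_hom_module K H m \<Delta> \<alpha> \<psi> R n s t M \<alpha>\<^sub>M act
    by (intro twist_invariant_hom_module.intro twist_invariant_hom_module_axioms.intro assms)
  show ?thesis
    unfolding Let_def braid_def[symmetric] using braid_tens hom_yang_baxter_braid by blast
qed

end
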